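(* Let $n,k\ge 1$ be integers. The correspondence $D\mapsto \phi_n^{(k)}(D)$ is a well-defined bijection of $\mathrm{PF}_{n,kn}$ onto itself such that, for every $D\in \mathrm{PF}_{n,kn}$, $$\mathrm{area}(\phi_n^{(k)}(D))=\mathrm{dinv}(D)\qquad\text{and}\qquad \mathrm{pmaj}(\phi_n^{(k)}(D))=\mathrm{area}(D).$$
   Context: Fix integers $n,k\ge1$; write $[m]=\{1,\dots,m\}$. **Parking functions.** A Dyck path in the $n\times kn$ grid is a lattice path from $(0,0)$ to $(kn,n)$ made of unit north and unit east steps that never goes below the main diagonal $y=x/k$. Rows are numbered from bottom to top and columns from left to right, starting from $1$. An $(n,kn)$-parking function is such a path whose $n$ north steps are labelled bijectively by $[n]$, so that labels of north steps on the same vertical line increase from bottom to top. $\mathrm{PF}_{n,kn}$ is the set of them. For $D\in\mathrm{PF}_{n,kn}$ and $\lambda\in[n]$, $f_D(\lambda)$ is the column containing the unit square immediately to the right of the north step labelled $\lambda$ (so $f_D(\lambda)=a+1$ if that step lies on $x=a$). $D$ is determined by $f_D$, and a function $f:[n]\to[kn]$ equals some $f_D$ iff $\#f^{-1}([1+k(i-1)])\ge i$ for all $i\in[n]$. **Area.** $w_i(D)$ is the number of whole unit squares in row $i$ between the path and the main diagonal, i.e. $w_i(D)=k(i-1)-a$ if the north step in row $i$ lies on $x=a$. $\mathrm{area}(D)=\sum_{i=1}^n w_i(D)$. If $\lambda$ labels the north step in row $i$, put $a_\lambda(D)=w_i(D)$. **Dinv.** $\mathrm{Tdinv}(D)$ is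 the set of pairs of labels $(i,j)$ such that either (A) $f_D(i)<f_D(j)$, $i<j$ and $a_j(D)-k<a_i(D)\le a_j(D)$; or (B) $f_D(i)<f_D(j)$, $i>j$ and $a_j(D)<a_i(D)\le a_j(D)+k$. The main shadow of a north step from $(a,b)$ to $(a,b+1)$ is $\{(x,y)\in\mathbb R^2: x\le a,\ \frac1k(x-a)<y-b\le\frac1k(x-a)+1\}$. The main shadow of an east step from $(c,d)$ to $(c+1,d)$ is $\{(x,y)\in\mathbb R^2: y\le d,\ \frac1k(x-c-1)<y-d<\frac1k(x-c)\}$. Each east step is labelled with the label of the first north step of $D$ met by its main shadow, moving from the east step towards the west. $\mathrm{Dinvcorr}(D)$ is the multiset of pairs $(\lambda,\mu)$, one for each pair consisting of an east step (with label $\lambda$) and a north step (with label $\mu$) such that the east step is entirely contained in the main shadow of the north step. $\mathrm{Dinv}(D)$ is the multiset sum $\mathrm{Tdinv}(D)+\mathrm{Dinvcorr}(D)$, and $\mathrm{dinv}(D)=\#\mathrm{Dinv}(D)$ (with multiplicity). **The map $\phi_n^{(k)}$.** The diagonal reading word $\mathrm{wdiag}(D)=\sigma_1\cdots\sigma_n$ is the permutation obtained by reading the labels along diagonals parallel to $y=x/k$ from bottom to top, and from left to right along each diagonal (i.e. by increasing $a_\lambda(D)$, ties broken from left to right). For $\lambda\in[n]$ let $d_\lambda(D)$ be the number (with multiplicity) of pairs $(\sigma_i,\sigma_j)\in\mathrm{Dinv}(D)$ with $\sigma_{\max(i,j)}=\lambda$. Then $\phi_n^{(k)}(D)$ is defined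 to be the unique element of $\mathrm{PF}_{n,kn}$ with $f_{\phi_n^{(k)}(D)}(\sigma_i)=k(i-1)-d_{\sigma_i}(D)+1$ for all $i\in[n]$. **Pmaj.** Given $D\in\mathrm{PF}_{n,kn}$ define a word $\sigma_{\mathrm{pmaj}}(D)=\sigma_1\cdots\sigma_{kn}$ as follows. Set $B_0'=\varnothing$ and $\sigma_0=n+1$. For $m=1,\dots,kn$: let $B_m$ be the multiset obtained from $B_{m-1}'$ by adding $k$ copies of each label $\lambda$ with $f_D(\lambda)=m$; let $X_m$ be the multiset of the $a\in B_m$ with $a<\sigma_{m-1}$; let $\sigma_m=\max X_m$ if $X_m\ne\varnothing$ and $\sigma_m=\max B_m$ otherwise; let $B_m'$ be $B_m$ with one copy of $\sigma_m$ removed. For $\lambda\in[n]$, $p_\lambda(D)$ is the number of weak ascents before the leftmost occurrence of $\lambda$, i.e. the number of $j\ge1$ with $\sigma_j\le\sigma_{j+1}$ and $j+1\le$ the position of the leftmost $\lambda$. $\mathrm{pmaj}(D)=\sum_{\lambda\in[n]}p_\lambda(D)$.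
   Formalization: The main shadow of a north step is taken as x ≤ a, (x−a)/k < y−b ≤ (x−a)/k+1 (strict and weak inequalities swapped), since with the printed inequalities the claim fails for n=k=2: one parking function has dinv 0 but two have area 0. *)

theory Defs
  imports Complex_Main "HOL-Library.Multiset"
begin

section \<open>Labelled lattice paths and parking functions\<close>

text \<open>A labelled lattice path starts at $(0,0)$; every north step carries its label.\<close>

datatype step = North nat | East

type_synonym path = "step list"

fun is_north :: "step \<Rightarrow> bool" where
  "is_north (North _) = True"
| "is_north East = False"

fun lab :: "step \<Rightarrow> nat" where
  "lab (North l) = l"
| "lab East = 0"

definition easts :: "path \<Rightarrow> nat" where
  "easts D = length (filter (\<lambda>s. s = East) D)"

definition norths :: "path \<Rightarrow> nat" where
  "norths D = length (filter is_north D)"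

text \<open>The labels of the north steps in path order, i.e. by increasing row.\<close>

definition labels :: "path \<Rightarrow> nat list" where
  "labels D = map lab (filter is_north D)"

text \<open>The step \<open>D ! p\<close> starts at the point \<open>(easts (take p D), norths (take p D))\<close>.
  That the path stays weakly above \<open>y = x / k\<close> is required at its lattice points, written
  without division.\<close>

definition PF :: "nat \<Rightarrow> nat \<Rightarrow> path set" where
  "PF n k = {D.
     easts D = k * n \<and>
     distinct (labels D) \<and> set (labels D) = {1..n} \<and>
     (\<forall>p \<le> length D. easts (take p D) \<le> k * norths (take p D)) \<and>
     (\<forall>p q l m. p < q \<and> q < length D \<and> D ! p = North l \<and> D ! q = North m \<and>
        easts (take p D) = easts (take q D) \<longrightarrow> l < m)}"

text \<open>The lower endpoint \<open>(xpos D l, ypos D l)\<close> of the north step labelled \<open>l\<close>.\<close>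

definition xpos :: "path \<Rightarrow> nat \<Rightarrow> nat" where
  "xpos D l = easts (takeWhile (\<lambda>s. s \<noteq> North l) D)"

definition ypos :: "path \<Rightarrow> nat \<Rightarrow> nat" where
  "ypos D l = norths (takeWhile (\<lambda>s. s \<noteq> North l) D)"

definition col :: "path \<Rightarrow> nat \<Rightarrow> nat" where
  "col D l = xpos D l + 1"

definition row_label :: "path \<Rightarrow> nat \<Rightarrow> nat" where
  "row_label D i = labels D ! (i - 1)"

definition row_of :: "path \<Rightarrow> nat \<Rightarrow> nat" where
  "row_of D l = ypos D l + 1"

section \<open>Area\<close>

definition row_area :: "nat \<Rightarrow> path \<Rightarrow> nat \<Rightarrow> int" where
  "row_area k D i = int k * (int i - 1) - int (xpos D (row_label D i))"

definition area :: "nat \<Rightarrow> nat \<Rightarrow> path \<Rightarrow> int" where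
  "area n k D = (\<Sum>i = 1..n. row_area k D i)"

definition lab_area :: "nat \<Rightarrow> path \<Rightarrow> nat \<Rightarrow> int" where
  "lab_area k D l = row_area k D (row_of D l)"

section \<open>Dinv\<close>

definition Tdinv :: "nat \<Rightarrow> nat \<Rightarrow> path \<Rightarrow> (nat \<times> nat) set" where
  "Tdinv n k D = {(i, j). i \<in> {1..n} \<and> j \<in> {1..n} \<and>
     (col D i < col D j \<and> i < j \<and>
        lab_area k D j - int k < lab_area k D i \<and> lab_area k D i \<le> lab_area k D j \<or>
      col D i < col D j \<and> i > j \<and>
        lab_area k D j < lab_area k D i \<and> lab_area k D i \<le> lab_area k D j + int k)}"

text \<open>Steps as closed segments in the plane, given by their starting points.\<close>

fun north_seg :: "nat \<times> nat \<Rightarrow> (real \<times> real) set" where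
  "north_seg (a, b) = {(x, y). x = real a \<and> real b \<le> y \<and> y \<le> real b + 1}"

fun east_seg :: "nat \<times> nat \<Rightarrow> (real \<times> real) set" where
  "east_seg (c, d) = {(x, y). real c \<le> x \<and> x \<le> real c + 1 \<and> y = real d}"

text \<open>The main shadow of a north step contains its upper boundary line and not its lower one.
  This is the convention matching the half-open intervals of \<^const>\<open>Tdinv\<close>. With the
  opposite one (lower line included, upper line excluded) the area and dinv statistics already
  fail to be equidistributed for $n = k = 2$: only one of the five parking functions would have
  dinv zero, while two have area zero.\<close>

fun north_shadow :: "nat \<Rightarrow> nat \<times> nat \<Rightarrow> (real \<times> real) set" where
  "north_shadow k (a, b) = {(x, y). x \<le> real a \<and>
     (1 / real k) * (x - real a) < y - real b \<and>
     y - real b \<le> (1 / real k) * (x - real a) + 1}"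

fun east_shadow :: "nat \<Rightarrow> nat \<times> nat \<Rightarrow> (real \<times> real) set" where
  "east_shadow k (c, d) = {(x, y). y \<le> real d \<and>
     (1 / real k) * (x - real c - 1) < y - real d \<and>
     y - real d < (1 / real k) * (x - real c)}"

definition east_steps :: "path \<Rightarrow> (nat \<times> nat) set" where
  "east_steps D = {(easts (take p D), norths (take p D)) | p. p < length D \<and> D ! p = East}"

definition met_by :: "nat \<Rightarrow> path \<Rightarrow> nat \<times> nat \<Rightarrow> nat set" where
  "met_by k D e =
     {l \<in> set (labels D). north_seg (xpos D l, ypos D l) \<inter> east_shadow k e \<noteq> {}}"

text \<open>Moving west, the first north step met is the one with the largest abscissa. It is unique:
  on a fixed vertical line $x = a$ the shadow lies strictly between two consecutive multiples of
  $1/k$.\<close>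

definition east_label :: "nat \<Rightarrow> path \<Rightarrow> nat \<times> nat \<Rightarrow> nat" where
  "east_label k D e =
     (THE l. l \<in> met_by k D e \<and> (\<forall>m \<in> met_by k D e. xpos D m \<le> xpos D l))"

definition Dinvcorr :: "nat \<Rightarrow> path \<Rightarrow> (nat \<times> nat) multiset" where
  "Dinvcorr k D = image_mset (\<lambda>(e, m). (east_label k D e, m))
     (mset_set {(e, m). e \<in> east_steps D \<and> m \<in> set (labels D) \<and>
        east_seg e \<subseteq> north_shadow k (xpos D m, ypos D m)})"

definition Dinv :: "nat \<Rightarrow> nat \<Rightarrow> path \<Rightarrow> (nat \<times> nat) multiset" where
  "Dinv n k D = mset_set (Tdinv n k D) + Dinvcorr k D"

definition dinv :: "nat \<Rightarrow> nat \<Rightarrow> path \<Rightarrow> nat" where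
  "dinv n k D = size (Dinv n k D)"

section \<open>The map phi\<close>

text \<open>\<^const>\<open>sort_key\<close> is stable, so labels on the same diagonal stay in path order, i.e. are
  read from left to right.\<close>

definition wdiag :: "nat \<Rightarrow> path \<Rightarrow> nat list" where
  "wdiag k D = sort_key (lab_area k D) (labels D)"

definition sig :: "nat \<Rightarrow> path \<Rightarrow> nat \<Rightarrow> nat" where
  "sig k D i = wdiag k D ! (i - 1)"

definition lab_dinv :: "nat \<Rightarrow> nat \<Rightarrow> path \<Rightarrow> nat \<Rightarrow> nat" where
  "lab_dinv n k D l = size (filter_mset
     (\<lambda>(x, y). \<exists>i \<in> {1..n}. \<exists>j \<in> {1..n}.
        x = sig k D i \<and> y = sig k D j \<and> sig k D (max i j) = l)
     (Dinv n k D))"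

definition is_phi_image :: "nat \<Rightarrow> nat \<Rightarrow> path \<Rightarrow> path \<Rightarrow> bool" where
  "is_phi_image n k D E \<longleftrightarrow> E \<in> PF n k \<and>
     (\<forall>i \<in> {1..n}. int (col E (sig k D i)) =
        int k * (int i - 1) - int (lab_dinv n k D (sig k D i)) + 1)"

definition phi :: "nat \<Rightarrow> nat \<Rightarrow> path \<Rightarrow> path" where
  "phi n k D = (THE E. is_phi_image n k D E)"

section \<open>Pmaj\<close>

text \<open>\<open>pmaj_state n k D m\<close> is the letter number \<open>m\<close> of the word together with the multiset
  left over after its removal.\<close>

primrec pmaj_state :: "nat \<Rightarrow> nat \<Rightarrow> path \<Rightarrow> nat \<Rightarrow> nat \<times> nat multiset" where
  "pmaj_state n k D 0 = (n + 1, {#})"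
| "pmaj_state n k D (Suc m) =
     (let (s, B') = pmaj_state n k D m;
          B = B' + (\<Sum>l \<in> {l \<in> {1..n}. col D l = Suc m}. replicate_mset k l);
          X = filter_mset (\<lambda>a. a < s) B;
          t = (if X \<noteq> {#} then Max (set_mset X) else Max (set_mset B))
      in (t, B - {#t#}))"

definition pmaj_word :: "nat \<Rightarrow> nat \<Rightarrow> path \<Rightarrow> nat \<Rightarrow> nat" where
  "pmaj_word n k D m = fst (pmaj_state n k D m)"

definition leftmost :: "nat \<Rightarrow> nat \<Rightarrow> path \<Rightarrow> nat \<Rightarrow> nat" where
  "leftmost n k D l = (LEAST m. m \<in> {1..k * n} \<and> pmaj_word n k D m = l)"

definition lab_pmaj :: "nat \<Rightarrow> nat \<Rightarrow> path \<Rightarrow> nat \<Rightarrow> nat" where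
  "lab_pmaj n k D l = card {j. 1 \<le> j \<and> pmaj_word n k D j \<le> pmaj_word n k D (j + 1) \<and>
     j + 1 \<le> leftmost n k D l}"

definition pmaj :: "nat \<Rightarrow> nat \<Rightarrow> path \<Rightarrow> nat" where
  "pmaj n k D = (\<Sum>l = 1..n. lab_pmaj n k D l)"

end

theory Submission
  imports Defs
begin

text \<open>Write \<open>y l\<close> for the number of north steps below the one labelled \<open>l\<close>, \<open>x l\<close> for its abscissa
and \<open>ht l = k * y l - x l\<close> for the height of its lower endpoint over the diagonal, measured
horizontally. The area of a path is the sum of these heights.

The word \<open>pmaj_word\<close> splits at its weak ascents into strictly decreasing passes. Each pass
runs once through all labels present, so the \<open>k\<close> copies of a label are used in \<open>k\<close>
consecutive passes, and the whole word is known as soon as the first pass \<open>a l\<close> of every label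
is known. Label \<open>l\<close> starts in pass \<open>a l\<close> iff its copies arrive after the word has gone past
the place of \<open>l\<close> in pass \<open>a l - 1\<close> and not later than the place of \<open>l\<close> in pass \<open>a l\<close>. The
letters between these two places are the labels in \<open>nbrs n k a l\<close>. Locale \<open>passes\<close> turns
this into a criterion for \<open>lab_pmaj\<close> to equal a given function \<open>a\<close>.

On the other side, let \<open>u\<close> precede \<open>l\<close> in the diagonal reading word of \<open>D\<close>. Counting the
correction pairs through the matching of each north step with the \<open>k\<close> east steps that leave its
\<open>k\<close> levels (\<open>card_owned_steps\<close>), the pair of \<open>u\<close> and \<open>l\<close> occurs in \<open>Dinv\<close> with a
multiplicity that is \<open>k\<close> minus the number of copies of \<open>u\<close> used before the place of \<open>l\<close> in
pass \<open>ht l\<close>, plus one if \<open>u\<close> is a neighbour of \<open>l\<close> to the right of \<open>l\<close>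
(\<open>dinv_mult_before\<close>). Summing over \<open>u\<close>, the abscissa of \<open>l\<close> in \<open>phi n k D\<close> is the number of
letters before the place of \<open>l\<close> in pass \<open>ht l\<close>, minus the number of neighbours to the right
of \<open>l\<close> in \<open>D\<close>.

These facts fit together because a label of positive height always has a neighbour to its left
(\<open>nbr_left\<close>). For such a label the subtracted number is therefore smaller than the number of
neighbours, while first pass zero bounds the arrival time only from above. So the arrival time of
\<open>l\<close> in \<open>phi n k D\<close> falls into the window for first pass \<open>ht l\<close>, which means that
\<open>lab_pmaj n k (phi n k D) l = ht l\<close>. Summing over \<open>l\<close> gives the statement on pmaj. The
statement on dinv holds because both sides complete the sum of the new abscissae to
\<open>k * (0 + 1 + \<dots> + (n - 1))\<close>.

The map is injective: \<open>phi n k D\<close> determines the heights, as its pmaj contributions, and then for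
each label the number of neighbours to its right. If the labels are inserted by increasing height
and, at equal height, by decreasing label, then this number forces the place of each new label
(\<open>order_determined\<close>), so \<open>D\<close> can be recovered. A finite set admits no injection into itself
other than bijections.\<close>

section \<open>Slots of a word made of passes\<close>

lemma sum_of_bool_subset:
  assumes "finite B" "A \<subseteq> B"
  shows "(\<Sum>u \<in> B. of_bool (u \<in> A) :: nat) = card A"
proof -
  have "B \<inter> {u. u \<in> A} = A" using assms by blast
  then show ?thesis using assms by (simp add: of_bool_def sum.If_cases)
qed

text \<open>Slot \<open>(r, s)\<close> is the place of label \<open>s\<close> in pass \<open>r\<close>. If a label \<open>u\<close> is used in the
passes \<open>a u, \<dots>, a u + k - 1\<close>, this is the number of its copies used up to and including slot
\<open>(r, s)\<close>. The copies used strictly before slot \<open>(r, s)\<close> are counted by \<open>copies k a r (Suc s) u\<close>,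
as labels decrease within a pass.\<close>

definition copies :: "nat \<Rightarrow> (nat \<Rightarrow> nat) \<Rightarrow> nat \<Rightarrow> nat \<Rightarrow> nat \<Rightarrow> nat" where
  "copies k a r s u = min k ((if s \<le> u then Suc r else r) - a u)"

text \<open>The labels used between the slots \<open>(a l - 1, l)\<close> and \<open>(a l, l)\<close>: a larger label must be used in
pass \<open>a l\<close>, a smaller one in pass \<open>a l - 1\<close>.\<close>

definition nbrs :: "nat \<Rightarrow> nat \<Rightarrow> (nat \<Rightarrow> nat) \<Rightarrow> nat \<Rightarrow> nat set" where
  "nbrs n k a l = {u \<in> {1..n}. l < u \<and> a u \<le> a l \<and> a l < a u + k \<or>
                               u < l \<and> a u < a l \<and> a l \<le> a u + k}"

text \<open>Encodes the order by increasing \<open>a\<close>, then by decreasing label, in which every label comes after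
all its neighbours.\<close>

definition insertion_rank :: "nat \<Rightarrow> (nat \<Rightarrow> nat) \<Rightarrow> nat \<Rightarrow> nat" where
  "insertion_rank n a l = a l * Suc n + (n - l)"

lemma insertion_rank_less_iff:
  assumes "l \<in> {1..n}" "u \<in> {1..n}"
  shows "insertion_rank n a u < insertion_rank n a l \<longleftrightarrow> a u < a l \<or> a u = a l \<and> l < u"
proof -
  have less: "insertion_rank n a v < insertion_rank n a w"
    if "a v < a w" for v w
  proof -
    have "Suc (a v) * Suc n \<le> a w * Suc n" using that by (intro mult_le_mono1) simp
    then show ?thesis unfolding insertion_rank_def by simp
  qed
  show ?thesis
  proof (cases "a u = a l")
    case True
    then show ?thesis using assms by (auto simp: insertion_rank_def)
  next
    case False
    then consider "a u < a l" | "a l < a u" by linarith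
    then show ?thesis
    proof cases
      case 1
      then show ?thesis using less[OF 1] by simp
    next
      case 2
      then show ?thesis using less[OF 2] by simp
    qed
  qed
qed

lemma insertion_rank_nbrs:
  assumes "l \<in> {1..n}" "u \<in> nbrs n k a l"
  shows "insertion_rank n a u < insertion_rank n a l"
  using assms by (subst insertion_rank_less_iff) (auto simp: nbrs_def)

lemma finite_nbrs: "finite (nbrs n k a l)"
  by (simp add: nbrs_def)

section \<open>Heights of north steps\<close>

text \<open>The data of a parking function without its path: the lower endpoints of the labelled north steps,
where \<open>y\<close> orders the steps along the path.\<close>

locale parking =
  fixes n k :: nat and x y :: "nat \<Rightarrow> nat"
  assumes k_pos: "k \<ge> 1"
    and y_bij: "bij_betw y {1..n} {..<n}"
    and x_mono: "\<And>l m. l \<in> {1..n} \<Longrightarrow> m \<in> {1..n} \<Longrightarrow> y l < y m \<Longrightarrow> x l \<le> x m"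
    and x_eq: "\<And>l m. l \<in> {1..n} \<Longrightarrow> m \<in> {1..n} \<Longrightarrow> y l < y m \<Longrightarrow> x l = x m \<Longrightarrow> l < m"
    and x_le: "\<And>l. l \<in> {1..n} \<Longrightarrow> x l \<le> k * y l"
begin

definition ht :: "nat \<Rightarrow> nat" where
  "ht l = k * y l - x l"

lemma ht_eq: "l \<in> {1..n} \<Longrightarrow> ht l + x l = k * y l"
  using x_le by (simp add: ht_def)

lemma y_less: "l \<in> {1..n} \<Longrightarrow> y l < n"
  using y_bij by (auto simp: bij_betw_def)

lemma y_inj: "l \<in> {1..n} \<Longrightarrow> m \<in> {1..n} \<Longrightarrow> y l = y m \<longleftrightarrow> l = m"
  using y_bij inj_on_eq_iff[of y "{1..n}" l m] by (simp add: bij_betw_def)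

lemma y_surj: assumes "i < n" obtains l where "l \<in> {1..n}" "y l = i"
proof -
  have "i \<in> y ` {1..n}" using y_bij assms by (simp add: bij_betw_def)
  then show ?thesis using that by blast
qed

lemma card_y_less:
  assumes "i \<le> n"
  shows "card {u \<in> {1..n}. y u < i} = i"
proof -
  have "{..<i} \<subseteq> y ` {1..n}" using y_bij assms by (simp add: bij_betw_def)
  then have "y ` {u \<in> {1..n}. y u < i} = {..<i}" by blast
  moreover have "inj_on y {u \<in> {1..n}. y u < i}"
    by (rule inj_on_subset[OF bij_betw_imp_inj_on[OF y_bij]]) blast
  ultimately show ?thesis using card_image[of y "{u \<in> {1..n}. y u < i}"] by simp
qed

text \<open>From one north step to the next the path rises once and never moves left, so the height grows by
at most \<open>k\<close>, with equality only on a common vertical line, where labels increase.\<close>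

lemma successor_ht:
  assumes "u \<in> {1..n}" "v \<in> {1..n}" "y v = Suc (y u)"
  shows "ht v \<le> ht u + k" and "ht v = ht u + k \<Longrightarrow> u < v"
proof -
  have *: "k * y v = k * y u + k" using assms by simp
  have le: "x u \<le> x v" using x_mono[of u v] assms by simp
  show "ht v \<le> ht u + k" using * le ht_eq[of u] ht_eq[of v] assms by linarith
  assume "ht v = ht u + k"
  then have "x u = x v" using * ht_eq[of u] ht_eq[of v] assms by linarith
  then show "u < v" using x_eq[of u v] assms by simp
qed

text \<open>Take the last step \<open>u\<close> before \<open>l\<close> that is lower than \<open>l\<close>. The step after it has at least
the height of \<open>l\<close>, so \<open>u\<close> is at most \<open>k\<close> lower than \<open>l\<close>. This makes \<open>u\<close> a
neighbour, unless \<open>u\<close> is the larger label and exactly \<open>k\<close> lower. In that case the step after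
\<open>u\<close> stands directly on \<open>u\<close>, has the height of \<open>l\<close> and an even larger label, and it is the
neighbour wanted.\<close>

lemma nbr_between:
  assumes l: "l \<in> {1..n}" and w: "w \<in> {1..n}" "y w < y l" "ht w < ht l"
  shows "\<exists>v \<in> nbrs n k ht l. y w \<le> y v \<and> y v < y l"
proof -
  define A where "A = {u \<in> {1..n}. y u < y l \<and> ht u < ht l}"
  have fin: "finite (y ` A)" "y ` A \<noteq> {}" using w by (auto simp: A_def)
  obtain u where u: "u \<in> A" "y u = Max (y ` A)"
    using Max_in[OF fin] by (metis imageE)
  have u_max: "y m \<le> y u" if "m \<in> A" for m
    using that u(2) fin(1) by simp
  have wu: "y w \<le> y u" using u_max[of w] w by (simp add: A_def)
  have u': "u \<in> {1..n}" "y u < y l" "ht u < ht l" using u by (auto simp: A_def)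
  have "Suc (y u) < n" using u' y_less[OF l] by simp
  then obtain v where v: "v \<in> {1..n}" "y v = Suc (y u)" by (rule y_surj)
  have vl: "v = l \<or> y v < y l" using v u' y_inj[OF v(1) l] by linarith
  have hv: "ht l \<le> ht v"
  proof (rule ccontr)
    assume "\<not> ht l \<le> ht v"
    then have "v \<in> A" using vl v by (auto simp: A_def)
    then show False using u_max[of v] v by simp
  qed
  note succ = successor_ht[OF u'(1) v]
  show ?thesis
  proof (cases "u < l \<or> ht l < ht u + k")
    case True
    moreover have "u \<noteq> l" using u' by auto
    moreover have "ht l \<le> ht u + k" "ht u \<le> ht l" using hv succ(1) u' by linarith+
    ultimately have "u \<in> nbrs n k ht l"
      unfolding nbrs_def using u' by (cases "u < l") simp_all
    then show ?thesis using wu u' by blast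
  next
    case False
    then have "ht v = ht u + k" using hv succ(1) by linarith
    then have "u < v" by (rule succ(2))
    have "u \<noteq> l" using u' by auto
    then have "l < v" using False \<open>u < v\<close> by linarith
    then have "y v < y l" using vl by simp
    moreover have "v \<in> nbrs n k ht l"
      using \<open>l < v\<close> v False hv succ(1) k_pos by (auto simp: nbrs_def)
    ultimately show ?thesis using wu v by (intro bexI[of _ v]) auto
  qed
qed

lemma nbr_left:
  assumes "l \<in> {1..n}" "ht l > 0"
  shows "\<exists>v \<in> nbrs n k ht l. y v < y l"
proof -
  have "y l > 0" using assms ht_eq[of l] by (cases "y l") auto
  then have "0 < n" using y_less[OF assms(1)] by simp
  then obtain w where w: "w \<in> {1..n}" "y w = 0" by (rule y_surj)
  then have "ht w = 0" using ht_eq[of w] by simp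
  then show ?thesis
    using nbr_between[of l w] assms w \<open>y l > 0\<close> by auto
qed

end

section \<open>Heights and blocked neighbours determine a parking function\<close>

text \<open>Insertion in the order of \<open>insertion_rank\<close>. The neighbours of \<open>l\<close> are inserted before \<open>l\<close>, and
those to the right of \<open>l\<close> form a final segment of them, so their number determines on which side
of \<open>l\<close> each neighbour lies. An earlier label \<open>u\<close> that is no neighbour is lower than \<open>l\<close>. By
\<open>nbr_between\<close> it lies to the left of \<open>l\<close> iff it lies to the left of some neighbour that does.\<close>

lemma order_determined:
  assumes P: "parking n k x y" and P': "parking n k x' y'"
    and same_ht: "\<And>l. l \<in> {1..n} \<Longrightarrow> parking.ht k x y l = parking.ht k x' y' l"
    and same_card: "\<And>l. l \<in> {1..n} \<Longrightarrow>
      card {u \<in> nbrs n k (parking.ht k x y) l. y l < y u} =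
      card {u \<in> nbrs n k (parking.ht k x' y') l. y' l < y' u}"
    and "l \<in> {1..n}" "m \<in> {1..n}"
  shows "y m < y l \<longleftrightarrow> y' m < y' l"
proof -
  interpret P: parking n k x y by fact
  interpret P': parking n k x' y' by fact
  define U where "U = nbrs n k P.ht"
  have U': "nbrs n k P'.ht l = U l" if "l \<in> {1..n}" for l
    using same_ht that by (auto simp: U_def nbrs_def)
  have U_sub: "U l \<subseteq> {1..n}" for l by (auto simp: U_def nbrs_def)
  define \<rho> where "\<rho> = insertion_rank n P.ht"
  have earlier: "\<forall>u \<in> {1..n}. \<rho> u < \<rho> l \<longrightarrow> (y u < y l \<longleftrightarrow> y' u < y' l)"
    if "l \<in> {1..n}" for l
    using that
  proof (induction "\<rho> l" arbitrary: l rule: less_induct)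
    case less
    note l = \<open>l \<in> {1..n}\<close>
    have agree: "y u < y w \<longleftrightarrow> y' u < y' w"
      if uw: "u \<in> {1..n}" "w \<in> {1..n}" "\<rho> u < \<rho> l" "\<rho> w < \<rho> l" for u w
    proof -
      consider "u = w" | "\<rho> u < \<rho> w" | "\<rho> w < \<rho> u"
        using insertion_rank_less_iff[OF uw(1,2), of P.ht] insertion_rank_less_iff[OF uw(2,1), of P.ht]
        by (fold \<rho>_def) linarith
      then show ?thesis
      proof cases
        case 2
        then show ?thesis using less.hyps[of w] uw by blast
      next
        case 3
        then have "y w < y u \<longleftrightarrow> y' w < y' u" "u \<noteq> w" using less.hyps[of u] uw by auto
        then show ?thesis using P.y_inj[OF uw(1,2)] P'.y_inj[OF uw(1,2)] by linarith
      qed simp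
    qed
    have U_rank: "\<rho> u < \<rho> l" if "u \<in> U l" for u
      using insertion_rank_nbrs[OF l] that by (simp add: U_def \<rho>_def)
    have U_ne: "u \<in> {1..n} \<and> u \<noteq> l" if "u \<in> U l" for u
      using U_rank[OF that] that U_sub[of l] by blast
    define V where "V = {u \<in> U l. y l < y u}"
    define V' where "V' = {u \<in> U l. y' l < y' u}"
    have fin: "finite V" "finite V'" by (auto simp: V_def V'_def U_def finite_nbrs)
    have card: "card V = card V'"
      using same_card[OF l] U'[OF l] by (simp add: V_def V'_def U_def)
    \<comment> \<open>two final segments of the same size in the same linear order\<close>
    have VV': "V = V'"
    proof (rule ccontr)
      assume ne: "V \<noteq> V'"
      have "\<not> V \<subseteq> V'" using card_subset_eq[OF fin(2)] card ne by auto
      moreover have "\<not> V' \<subseteq> V" using card_subset_eq[OF fin(1)] card ne by auto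
      ultimately obtain v v' where v: "v \<in> V" "v \<notin> V'" and v': "v' \<in> V'" "v' \<notin> V" by blast
      have vU: "v \<in> U l" "v' \<in> U l" using v v' by (auto simp: V_def V'_def)
      have "y v' < y v"
        using v v' vU U_ne P.y_inj[of v' l] l by (auto simp: V_def V'_def)
      moreover have "y' v < y' v'"
        using v v' vU U_ne P'.y_inj[of v l] l by (auto simp: V_def V'_def)
      ultimately show False using agree[of v' v] vU U_rank U_ne by auto
    qed
    have inU: "y u < y l \<longleftrightarrow> y' u < y' l" if "u \<in> U l" for u
    proof -
      have "y l < y u \<longleftrightarrow> y' l < y' u" using VV' that by (auto simp: V_def V'_def)
      then show ?thesis using U_ne[OF that] P.y_inj[of u l] P'.y_inj[of u l] l by linarith
    qed
    show ?case
    proof (intro ballI impI)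
      fix u assume u: "u \<in> {1..n}" "\<rho> u < \<rho> l"
      show "y u < y l \<longleftrightarrow> y' u < y' l"
      proof (cases "u \<in> U l")
        case False
        have hu: "P.ht u < P.ht l"
        proof -
          have "P.ht u < P.ht l \<or> P.ht u = P.ht l \<and> l < u"
            using u insertion_rank_less_iff[OF l u(1)] by (simp add: \<rho>_def)
          then show ?thesis using False u P.k_pos by (auto simp: U_def nbrs_def)
        qed
        have "\<exists>v \<in> U l. y u < y v \<and> y v < y l" if yul: "y u < y l"
        proof -
          obtain v where v: "v \<in> U l" "y u \<le> y v" "y v < y l"
            using P.nbr_between[OF l u(1) yul hu] by (auto simp: U_def)
          then have "y u \<noteq> y v" using False U_ne[of v] P.y_inj[OF u(1), of v] by auto
          then show ?thesis using v by (intro bexI[of _ v]) auto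
        qed
        then have "y u < y l \<longleftrightarrow> (\<exists>v \<in> U l. y u < y v \<and> y v < y l)" by auto
        moreover have "\<exists>v \<in> U l. y' u < y' v \<and> y' v < y' l" if yul: "y' u < y' l"
        proof -
          have "P'.ht u < P'.ht l" using hu same_ht l u(1) by simp
          then obtain v where v: "v \<in> U l" "y' u \<le> y' v" "y' v < y' l"
            using P'.nbr_between[OF l u(1) yul] U'[OF l] by auto
          then have "y' u \<noteq> y' v" using False U_ne[of v] P'.y_inj[OF u(1), of v] by auto
          then show ?thesis using v by (intro bexI[of _ v]) auto
        qed
        then have "y' u < y' l \<longleftrightarrow> (\<exists>v \<in> U l. y' u < y' v \<and> y' v < y' l)" by auto
        moreover have "(y u < y v \<and> y v < y l) \<longleftrightarrow> (y' u < y' v \<and> y' v < y' l)" if "v \<in> U l" for v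
          using agree[of u v] u U_ne[OF that] U_rank[OF that] inU[OF that] by blast
        ultimately show ?thesis by blast
      qed (use inU in blast)
    qed
  qed
  consider "l = m" | "\<rho> m < \<rho> l" | "\<rho> l < \<rho> m"
    using insertion_rank_less_iff[OF assms(5,6), of P.ht] insertion_rank_less_iff[OF assms(6,5), of P.ht]
    by (fold \<rho>_def) linarith
  then show ?thesis
  proof cases
    case 2
    then show ?thesis using earlier assms by blast
  next
    case 3
    then have "y l < y m \<longleftrightarrow> y' l < y' m" "l \<noteq> m" using earlier assms by auto
    then show ?thesis using P.y_inj[OF assms(5,6)] P'.y_inj[OF assms(5,6)] by linarith
  qed simp
qed

lemma parking_determined:
  assumes P: "parking n k x y" and P': "parking n k x' y'"
    and same_ht: "\<And>l. l \<in> {1..n} \<Longrightarrow> parking.ht k x y l = parking.ht k x' y' l"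
    and same_card: "\<And>l. l \<in> {1..n} \<Longrightarrow>
      card {u \<in> nbrs n k (parking.ht k x y) l. y l < y u} =
      card {u \<in> nbrs n k (parking.ht k x' y') l. y' l < y' u}"
    and l: "l \<in> {1..n}"
  shows "x l = x' l"
proof -
  interpret P: parking n k x y by fact
  interpret P': parking n k x' y' by fact
  have "{u \<in> {1..n}. y u < y l} = {u \<in> {1..n}. y' u < y' l}"
    using order_determined[OF P P' same_ht same_card l] by auto
  then have "y l = y' l"
    using P.card_y_less[of "y l"] P'.card_y_less[of "y' l"] P.y_less[OF l] P'.y_less[OF l] by simp
  then show ?thesis using P.ht_eq[OF l] P'.ht_eq[OF l] same_ht[OF l] by simp
qed

section \<open>The pmaj word is a sequence of passes\<close>

text \<open>The two bounds on the column say that label \<open>l\<close> arrives in time for slot \<open>(a l, l)\<close> but too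
late for slot \<open>(a l - 1, l)\<close>. Every letter takes one unit of time, so the sums are the numbers of
letters before these slots.\<close>

locale passes =
  fixes n k :: nat and a :: "nat \<Rightarrow> nat" and E :: path
  assumes k_pos: "k \<ge> 1"
    and nbrs_nonempty: "\<And>l. l \<in> {1..n} \<Longrightarrow> a l > 0 \<Longrightarrow> nbrs n k a l \<noteq> {}"
    and col_le: "\<And>l. l \<in> {1..n} \<Longrightarrow> col E l \<le> Suc (\<Sum>u = 1..n. copies k a (a l) (Suc l) u)"
    and col_gt: "\<And>l r. l \<in> {1..n} \<Longrightarrow> a l = Suc r \<Longrightarrow>
      Suc (\<Sum>u = 1..n. copies k a r (Suc l) u) < col E l"
begin

definition active :: "nat \<Rightarrow> nat \<Rightarrow> bool" where
  "active r u \<longleftrightarrow> u \<in> {1..n} \<and> a u \<le> r \<and> r < a u + k"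

text \<open>While a label is not used up, no pass is empty. Otherwise take the first label \<open>l\<close> in insertion
order that starts after the empty pass \<open>r\<close>. A neighbour of \<open>l\<close> comes earlier in that order, so it
does not start after pass \<open>r\<close>. But it is used in pass \<open>a l\<close> or \<open>a l - 1\<close>, neither of which is
before pass \<open>r\<close>, hence also in pass \<open>r\<close>.\<close>

lemma pass_nonempty:
  assumes "w \<in> {1..n}" "r < a w + k"
  shows "\<exists>u. active r u"
proof (rule ccontr)
  assume none: "\<nexists>u. active r u"
  have "\<not> a w \<le> r" using none assms unfolding active_def by blast
  then have ex: "w \<in> {1..n} \<and> r < a w" using assms(1) by simp
  define l where "l = arg_min (insertion_rank n a) (\<lambda>l. l \<in> {1..n} \<and> r < a l)"
  have l: "l \<in> {1..n}" "r < a l"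
    using arg_min_natI[of "\<lambda>l. l \<in> {1..n} \<and> r < a l", OF ex] by (auto simp: l_def)
  have min: "insertion_rank n a l \<le> insertion_rank n a v" if "v \<in> {1..n}" "r < a v" for v
    using arg_min_nat_le[of "\<lambda>l. l \<in> {1..n} \<and> r < a l" v] that by (simp add: l_def)
  obtain v where v: "v \<in> nbrs n k a l" using nbrs_nonempty[OF l(1)] l(2) by auto
  have v1: "v \<in> {1..n}" "a l \<le> a v + k" using v by (auto simp: nbrs_def)
  have "insertion_rank n a v < insertion_rank n a l" using insertion_rank_nbrs[OF l(1) v] .
  then have "\<not> r < a v" using min[of v] v1 by auto
  then have "active r v" unfolding active_def using v1 l(2) by linarith
  then show False using none by blast
qed

lemma col_gt':
  assumes "l \<in> {1..n}" "r < a l"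
  shows "Suc (\<Sum>u = 1..n. copies k a r (Suc l) u) < col E l"
proof -
  obtain r' where r': "a l = Suc r'" "r \<le> r'" using assms by (cases "a l") auto
  have "(\<Sum>u = 1..n. copies k a r (Suc l) u) \<le> (\<Sum>u = 1..n. copies k a r' (Suc l) u)"
    using r' by (intro sum_mono) (auto simp: copies_def)
  then show ?thesis using col_gt[OF assms(1) r'(1)] by linarith
qed

text \<open>The situation when the letter at time \<open>m\<close> was the one in slot \<open>(r, s)\<close>, with \<open>B\<close> left over. The
letters so far are the copies counted by \<open>copies\<close>; all of them belong to labels that have arrived.\<close>

definition pass_state :: "nat \<Rightarrow> nat \<Rightarrow> nat \<Rightarrow> nat multiset \<Rightarrow> bool" where
  "pass_state m r s B \<longleftrightarrow> m = (\<Sum>u = 1..n. copies k a r s u) \<and>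
     (\<forall>u. count B u = (if u \<in> {1..n} \<and> col E u \<le> m then k - copies k a r s u else 0)) \<and>
     (\<forall>u \<in> {1..n}. m < col E u \<longrightarrow> copies k a r s u = 0)"

lemma pass_stateD:
  assumes "pass_state m r s B"
  shows "m = (\<Sum>u = 1..n. copies k a r s u)"
    and "\<And>u. count B u = (if u \<in> {1..n} \<and> col E u \<le> m then k - copies k a r s u else 0)"
    and "\<And>u. u \<in> {1..n} \<Longrightarrow> m < col E u \<Longrightarrow> copies k a r s u = 0"
  using assms unfolding pass_state_def by blast+

definition arrivals :: "nat \<Rightarrow> nat multiset" where
  "arrivals m = (\<Sum>l \<in> {l \<in> {1..n}. col E l = m}. replicate_mset k l)"

lemma count_arrivals: "count (arrivals m) u = (if u \<in> {1..n} \<and> col E u = m then k else 0)"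
proof -
  have "count (arrivals m) u = (\<Sum>l \<in> {l \<in> {1..n}. col E l = m}. if l = u then k else 0)"
    by (simp add: arrivals_def count_sum)
  also have "\<dots> = (if u \<in> {1..n} \<and> col E u = m then k else 0)"
    by (subst sum.delta) auto
  finally show ?thesis .
qed

lemma count_after_arrivals:
  assumes "pass_state m r s B"
  shows "count (B + arrivals (Suc m)) u =
    (if u \<in> {1..n} \<and> col E u \<le> Suc m then k - copies k a r s u else 0)"
proof -
  consider "u \<notin> {1..n}" | "u \<in> {1..n}" "col E u = Suc m" | "u \<in> {1..n}" "col E u \<noteq> Suc m"
    by blast
  then show ?thesis
  proof cases
    case 2
    then have "copies k a r s u = 0" using pass_stateD(3)[OF assms, of u] by simp
    then show ?thesis using 2 by (simp add: pass_stateD(2)[OF assms] count_arrivals)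
  next
    case 3
    then have "col E u \<le> Suc m \<longleftrightarrow> col E u \<le> m" by linarith
    then show ?thesis using 3 by (simp add: pass_stateD(2)[OF assms] count_arrivals)
  qed (simp add: pass_stateD(2)[OF assms] count_arrivals del: atLeastAtMost_iff)
qed

text \<open>No slot strictly between \<open>(r, s)\<close> and \<open>(r, t)\<close> is in use.\<close>

lemma copies_skip:
  assumes "t < s" "\<And>u. active r u \<Longrightarrow> t < u \<Longrightarrow> \<not> u < s" "u \<in> {1..n}"
  shows "copies k a r (Suc t) u = copies k a r s u"
proof (cases "t < u \<and> u < s")
  case True
  then have "\<not> active r u" using assms(2) by blast
  then have "r < a u \<or> a u + k \<le> r" using assms(3) unfolding active_def by linarith
  then show ?thesis unfolding copies_def by auto
next
  case False
  then have "Suc t \<le> u \<longleftrightarrow> s \<le> u" using assms(1) by linarith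
  then show ?thesis by (simp add: copies_def)
qed

text \<open>If no label from \<open>u\<close> upwards and below \<open>s\<close> is active in pass \<open>r\<close>, then \<open>u\<close> is really
absent: either it starts in a later pass and has not arrived yet, or it belongs to earlier passes
and is used up.\<close>

lemma not_available:
  assumes inv: "pass_state m r s B" and u: "u < s"
    and skip: "\<And>v. active r v \<Longrightarrow> u \<le> v \<Longrightarrow> \<not> v < s"
  shows "count (B + arrivals (Suc m)) u = 0"
proof (cases "u \<in> {1..n}")
  case True
  have "(\<Sum>v = 1..n. copies k a r (Suc u) v) = (\<Sum>v = 1..n. copies k a r s v)"
    using skip u by (intro sum.cong refl copies_skip) auto
  then have m: "m = (\<Sum>v = 1..n. copies k a r (Suc u) v)" using pass_stateD(1)[OF inv] by simp
  have "\<not> active r u" using skip u by blast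
  then consider "r < a u" | "a u + k \<le> r" using True by (auto simp: active_def)
  then show ?thesis
  proof cases
    case 1
    then have "Suc m < col E u" using col_gt'[OF True 1] m by simp
    then show ?thesis unfolding count_after_arrivals[OF inv] by simp
  next
    case 2
    then have "copies k a r s u = k" by (auto simp: copies_def)
    then show ?thesis unfolding count_after_arrivals[OF inv] by simp
  qed
qed (unfold count_after_arrivals[OF inv], auto)

text \<open>If pass \<open>r\<close> still contains a label below \<open>s\<close>, then the next letter is the largest such label:
it has arrived in time, and by \<open>not_available\<close> nothing lies between it and \<open>s\<close>.\<close>

lemma pass_continues:
  assumes inv: "pass_state m r s B" and t: "active r t" "t < s"
    and skip: "\<And>u. active r u \<Longrightarrow> t < u \<Longrightarrow> \<not> u < s"
  defines "C \<equiv> B + arrivals (Suc m)"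
  shows "filter_mset (\<lambda>b. b < s) C \<noteq> {#}" "Max (set_mset (filter_mset (\<lambda>b. b < s) C)) = t"
    "pass_state (Suc m) r t (C - {#t#})" "t \<in># C"
    "\<And>u. u \<in> {1..n} \<Longrightarrow> copies k a r t u = copies k a r s u + (if u = t then 1 else 0)"
proof -
  have tn: "t \<in> {1..n}" "a t \<le> r" "r < a t + k" using t by (auto simp: active_def)
  have "(\<Sum>v = 1..n. copies k a r (Suc t) v) = (\<Sum>v = 1..n. copies k a r s v)"
    using skip t(2) by (intro sum.cong refl copies_skip) auto
  then have m: "m = (\<Sum>v = 1..n. copies k a r (Suc t) v)" using pass_stateD(1)[OF inv] by simp
  have "(\<Sum>v = 1..n. copies k a (a t) (Suc t) v) \<le> (\<Sum>v = 1..n. copies k a r (Suc t) v)"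
    using tn by (intro sum_mono) (auto simp: copies_def)
  then have colt: "col E t \<le> Suc m" using col_le[OF tn(1)] m by linarith
  have ct: "copies k a r s t = r - a t" using tn t by (auto simp: copies_def)
  have countC: "count C u = (if u \<in> {1..n} \<and> col E u \<le> Suc m then k - copies k a r s u else 0)" for u
    unfolding C_def by (rule count_after_arrivals[OF inv])
  have "count C t > 0" using countC[of t] tn colt ct by simp
  then show tC: "t \<in># C" by simp
  then show "filter_mset (\<lambda>b. b < s) C \<noteq> {#}"
    using t by (metis (mono_tags, lifting) empty_iff set_mset_empty set_mset_filter mem_Collect_eq)
  show "Max (set_mset (filter_mset (\<lambda>b. b < s) C)) = t"
  proof (rule Max_eqI)
    fix u assume "u \<in> set_mset (filter_mset (\<lambda>b. b < s) C)"
    then have u: "u < s" "count C u \<noteq> 0" by (auto simp: count_eq_zero_iff)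
    show "u \<le> t"
    proof (rule ccontr)
      assume "\<not> u \<le> t"
      then have "\<And>v. active r v \<Longrightarrow> u \<le> v \<Longrightarrow> \<not> v < s" using skip by force
      then have "count C u = 0" unfolding C_def by (rule not_available[OF inv u(1)])
      then show False using u by simp
    qed
  qed (use tC t in auto)
  show cp: "copies k a r t u = copies k a r s u + (if u = t then 1 else 0)" if "u \<in> {1..n}" for u
  proof (cases "u = t")
    case True
    then show ?thesis using ct tn by (auto simp: copies_def)
  next
    case False
    then have "copies k a r t u = copies k a r (Suc t) u" by (auto simp: copies_def)
    then show ?thesis using copies_skip[OF t(2) skip that] False by simp
  qed
  show "pass_state (Suc m) r t (C - {#t#})"
    unfolding pass_state_def
  proof (intro conjI allI ballI impI)
    have "(\<Sum>u = 1..n. copies k a r t u) = (\<Sum>u = 1..n. copies k a r s u + (if u = t then 1 else 0))"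
      by (intro sum.cong refl cp) auto
    also have "\<dots> = m + 1" using pass_stateD(1)[OF inv] tn by (simp add: sum.distrib)
    finally show "Suc m = (\<Sum>u = 1..n. copies k a r t u)" by simp
    show "count (C - {#t#}) u = (if u \<in> {1..n} \<and> col E u \<le> Suc m then k - copies k a r t u else 0)" for u
      using countC[of u] cp[of u] tn colt by auto
    show "copies k a r t u = 0" if "u \<in> {1..n}" "Suc m < col E u" for u
      using cp[OF that(1)] that colt pass_stateD(3)[OF inv that(1)] by auto
  qed
qed

text \<open>If pass \<open>r\<close> contains no label below \<open>s\<close>, then nothing smaller than \<open>s\<close> is available, and
slot \<open>(r, s)\<close> may be replaced by the virtual slot of \<open>Suc n\<close> at the start of pass \<open>Suc r\<close>.
This reduces a change of pass to the previous lemma.\<close>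

lemma pass_ends:
  assumes inv: "pass_state m r s B" and none: "\<And>u. active r u \<Longrightarrow> \<not> u < s"
  shows "pass_state m (Suc r) (Suc n) B" "filter_mset (\<lambda>b. b < s) (B + arrivals (Suc m)) = {#}"
    "\<And>u. u \<in> {1..n} \<Longrightarrow> copies k a (Suc r) (Suc n) u = copies k a r s u"
proof -
  show cp: "copies k a (Suc r) (Suc n) u = copies k a r s u" if "u \<in> {1..n}" for u
  proof (cases "u < s")
    case True
    then have "r < a u \<or> a u + k \<le> r" using none[of u] that unfolding active_def by linarith
    then show ?thesis using True that by (auto simp: copies_def)
  next
    case False
    then show ?thesis using that by (simp add: copies_def)
  qed
  have total: "(\<Sum>u = 1..n. copies k a (Suc r) (Suc n) u) = (\<Sum>u = 1..n. copies k a r s u)"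
    by (intro sum.cong refl cp)
  show "pass_state m (Suc r) (Suc n) B"
    unfolding pass_state_def
  proof (intro conjI allI ballI impI)
    show "m = (\<Sum>u = 1..n. copies k a (Suc r) (Suc n) u)"
      unfolding total by (rule pass_stateD(1)[OF inv])
    show "count B u = (if u \<in> {1..n} \<and> col E u \<le> m then k - copies k a (Suc r) (Suc n) u else 0)" for u
      unfolding pass_stateD(2)[OF inv] by (intro if_cong refl) (use cp in simp)
    show "copies k a (Suc r) (Suc n) u = 0" if "u \<in> {1..n}" "m < col E u" for u
      using cp[OF that(1)] pass_stateD(3)[OF inv that] by simp
  qed
  have "count (B + arrivals (Suc m)) u = 0" if "u < s" for u
    using that none by (intro not_available[OF inv]) auto
  then show "filter_mset (\<lambda>b. b < s) (B + arrivals (Suc m)) = {#}"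
    by (auto simp: multiset_eq_iff)
qed

abbreviation word :: "nat \<Rightarrow> nat" where
  "word \<equiv> pmaj_word n k E"

lemma pmaj_state_Suc:
  "pmaj_state n k E (Suc m) =
     (let s = word m; B = snd (pmaj_state n k E m) + arrivals (Suc m);
          X = filter_mset (\<lambda>b. b < s) B;
          t = (if X \<noteq> {#} then Max (set_mset X) else Max (set_mset B))
      in (t, B - {#t#}))"
  by (simp add: pmaj_word_def arrivals_def split_beta Let_def)

text \<open>The index of the pass grows exactly at weak ascents: within a pass letters decrease, and when a
pass ends every available letter is at least the last one.\<close>

lemma pmaj_step:
  assumes inv: "pass_state m r (word m) (snd (pmaj_state n k E m))" and m: "m < k * n"
  shows "\<exists>r'. pass_state (Suc m) r' (word (Suc m)) (snd (pmaj_state n k E (Suc m))) \<and>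
      active r' (word (Suc m)) \<and>
      r' = r + (if word m \<le> word (Suc m) then 1 else 0) \<and>
      (\<forall>u \<in> {1..n}. copies k a r' (word (Suc m)) u =
         copies k a r (word m) u + (if u = word (Suc m) then 1 else 0))"
proof -
  define s where "s = word m"
  define B where "B = snd (pmaj_state n k E m)"
  define C where "C = B + arrivals (Suc m)"
  note st = pmaj_state_Suc[of m, folded s_def B_def, folded C_def, unfolded Let_def]
  have inv': "pass_state m r s B" using inv by (simp add: s_def B_def)
  \<comment> \<open>the letter of pass \<open>r\<close> that follows the bound \<open>s\<close>\<close>
  have next_label: "\<exists>t. active r t \<and> t < s \<and> (\<forall>u. active r u \<longrightarrow> t < u \<longrightarrow> \<not> u < s)"
    if "active r w" "w < s" for r s w
  proof -
    define A where "A = {u. active r u \<and> u < s}"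
    have A: "finite A" "A \<noteq> {}" using that by (auto simp: A_def active_def)
    have "active r (Max A) \<and> Max A < s" using Max_in[OF A] by (simp add: A_def)
    moreover have "\<not> u < s" if "active r u" "Max A < u" for u
    proof
      assume "u < s"
      then have "u \<in> A" using that by (simp add: A_def)
      then show False using Max_ge[OF A(1)] that(2) by fastforce
    qed
    ultimately show ?thesis by blast
  qed
  show ?thesis
  proof (cases "\<exists>u. active r u \<and> u < s")
    case True
    then obtain t where t: "active r t" "t < s" "\<And>u. active r u \<Longrightarrow> t < u \<Longrightarrow> \<not> u < s"
      using next_label by blast
    note sc = pass_continues[OF inv' t, folded C_def]
    have "pmaj_state n k E (Suc m) = (t, C - {#t#})" using st sc(1,2) by simp
    then have w: "word (Suc m) = t" "snd (pmaj_state n k E (Suc m)) = C - {#t#}"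
      by (simp_all add: pmaj_word_def)
    show ?thesis unfolding w using sc(3,5) t
      by (intro exI[of _ r]) (auto simp flip: s_def)
  next
    case False
    then have none: "\<And>u. active r u \<Longrightarrow> \<not> u < s" by blast
    note tu = pass_ends[OF inv' none, folded C_def]
    have "\<exists>w \<in> {1..n}. copies k a (Suc r) (Suc n) w < k"
    proof (rule ccontr)
      assume "\<not> ?thesis"
      then have "(\<Sum>u = 1..n. copies k a (Suc r) (Suc n) u) \<ge> (\<Sum>u = 1..n. k)"
        by (intro sum_mono) (auto simp: not_less)
      then show False using pass_stateD(1)[OF tu(1)] m by (simp add: mult.commute)
    qed
    then obtain w where "w \<in> {1..n}" "Suc r < a w + k"
      by (auto simp: copies_def)
    then obtain w' where "active (Suc r) w'" using pass_nonempty by blast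
    moreover from this have "w' < Suc n" by (simp add: active_def)
    ultimately obtain t where t: "active (Suc r) t" "t < Suc n"
      "\<And>u. active (Suc r) u \<Longrightarrow> t < u \<Longrightarrow> \<not> u < Suc n"
      using next_label by blast
    note sc = pass_continues[OF tu(1) t, folded C_def]
    have "filter_mset (\<lambda>b. b < Suc n) C = C"
    proof -
      have "b < Suc n" if "b \<in># C" for b
        using that count_after_arrivals[OF inv', of b] unfolding C_def[symmetric]
        by (auto simp flip: count_greater_zero_iff split: if_splits)
      then show ?thesis by (simp add: filter_mset_eq_conv)
    qed
    then have "Max (set_mset C) = t" using sc(2) by simp
    then have "pmaj_state n k E (Suc m) = (t, C - {#t#})" using st tu(2) by simp
    then have w: "word (Suc m) = t" "snd (pmaj_state n k E (Suc m)) = C - {#t#}"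
      by (simp_all add: pmaj_word_def)
    have "s \<le> t"
    proof (rule ccontr)
      assume "\<not> s \<le> t"
      then have "t \<in># filter_mset (\<lambda>b. b < s) C" using sc(4) by simp
      then show False using tu(2) by simp
    qed
    then show ?thesis unfolding w using sc(3,5) t tu(3)
      by (intro exI[of _ "Suc r"]) (auto simp flip: s_def)
  qed
qed

text \<open>The last conjunct identifies the number of copies used with the number of occurrences in the
word, which later locates the leftmost occurrence of a label.\<close>

lemma pmaj_run:
  assumes "m \<le> k * n"
  shows "\<exists>r. pass_state m r (word m) (snd (pmaj_state n k E m)) \<and>
      (m > 0 \<longrightarrow> active r (word m)) \<and>
      r = card {j. j < m \<and> word j \<le> word (Suc j)} \<and>
      (\<forall>u \<in> {1..n}. copies k a r (word m) u = card {j \<in> {1..m}. word j = u})"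
  using assms
proof (induction m)
  case 0
  have "pass_state 0 0 (Suc n) {#}"
    by (auto simp: pass_state_def copies_def col_def)
  then show ?case by (auto simp: pmaj_word_def copies_def)
next
  case (Suc m)
  then obtain r where r: "pass_state m r (word m) (snd (pmaj_state n k E m))"
      "r = card {j. j < m \<and> word j \<le> word (Suc j)}"
      "\<forall>u \<in> {1..n}. copies k a r (word m) u = card {j \<in> {1..m}. word j = u}" by auto
  obtain r' where r': "pass_state (Suc m) r' (word (Suc m)) (snd (pmaj_state n k E (Suc m)))"
      "active r' (word (Suc m))" "r' = r + (if word m \<le> word (Suc m) then 1 else 0)"
      "\<forall>u \<in> {1..n}. copies k a r' (word (Suc m)) u =
         copies k a r (word m) u + (if u = word (Suc m) then 1 else 0)"
    using pmaj_step[OF r(1)] Suc.prems by auto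
  have "{j. j < Suc m \<and> word j \<le> word (Suc j)} =
      {j. j < m \<and> word j \<le> word (Suc j)} \<union> (if word m \<le> word (Suc m) then {m} else {})"
    by (auto simp: less_Suc_eq)
  then have 1: "r' = card {j. j < Suc m \<and> word j \<le> word (Suc j)}"
    using r'(3) r(2) by auto
  have "{j \<in> {1..Suc m}. word j = u} =
      {j \<in> {1..m}. word j = u} \<union> (if u = word (Suc m) then {Suc m} else {})" for u
    by (auto simp: le_Suc_eq)
  then have "card {j \<in> {1..Suc m}. word j = u} =
      card {j \<in> {1..m}. word j = u} + (if u = word (Suc m) then 1 else 0)" for u
    by auto
  then have 2: "\<forall>u \<in> {1..n}. copies k a r' (word (Suc m)) u = card {j \<in> {1..Suc m}. word j = u}"
    using r'(4) r(3) by simp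
  show ?case using r'(1,2) 1 2 by blast
qed

lemma lab_pmaj_eq:
  assumes l: "l \<in> {1..n}"
  shows "lab_pmaj n k E l = a l"
proof -
  have "\<exists>m. m \<in> {1..k * n} \<and> word m = l"
  proof -
    obtain r where r: "pass_state (k * n) r (word (k * n)) (snd (pmaj_state n k E (k * n)))"
      "\<forall>u \<in> {1..n}. copies k a r (word (k * n)) u = card {j \<in> {1..k * n}. word j = u}"
      using pmaj_run[of "k * n"] by blast
    have "copies k a r (word (k * n)) l \<noteq> 0"
    proof
      assume 0: "copies k a r (word (k * n)) l = 0"
      have "(\<Sum>u = 1..n. copies k a r (word (k * n)) u) < (\<Sum>u = 1..n. k)"
      proof (rule sum_strict_mono_ex1)
        show "\<forall>u \<in> {1..n}. copies k a r (word (k * n)) u \<le> k" by (simp add: copies_def)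
        show "\<exists>u \<in> {1..n}. copies k a r (word (k * n)) u < k"
          using 0 l k_pos by (intro bexI[of _ l]) simp_all
      qed simp
      then show False using pass_stateD(1)[OF r(1)] by (simp add: mult.commute)
    qed
    then have "{j \<in> {1..k * n}. word j = l} \<noteq> {}" using r(2) l by (metis card.empty)
    then show ?thesis by blast
  qed
  define m where "m = leftmost n k E l"
  have m: "m \<in> {1..k * n}" "word m = l"
    using LeastI_ex[OF \<open>\<exists>m. m \<in> {1..k * n} \<and> word m = l\<close>] by (auto simp: m_def leftmost_def)
  have least: "\<not> (j \<in> {1..k * n} \<and> word j = l)" if "j < m" for j
    using not_less_Least that unfolding m_def leftmost_def by blast
  obtain r where r: "active r (word m)" "r = card {j. j < m \<and> word j \<le> word (Suc j)}"
      "\<forall>u \<in> {1..n}. copies k a r (word m) u = card {j \<in> {1..m}. word j = u}"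
    using pmaj_run[of m] m by fastforce
  have "j = m" if "j \<in> {1..m}" "word j = l" for j
    using least[of j] that m(1) by (cases "j < m") auto
  then have "{j \<in> {1..m}. word j = l} = {m}" using m by auto
  then have "copies k a r l l = 1" using r(3) l m by auto
  then have "r = a l" using r(1) m by (auto simp: copies_def active_def min_def split: if_splits)
  moreover have "{j. 1 \<le> j \<and> word j \<le> word (j + 1) \<and> j + 1 \<le> m} = {j. j < m \<and> word j \<le> word (Suc j)}"
  proof -
    have "1 \<le> k * n" using m(1) by (meson atLeastAtMost_iff order_trans)
    then obtain r1 where "active r1 (word 1)" using pmaj_run[of 1] by auto
    then have "\<not> word 0 \<le> word (Suc 0)" by (auto simp: active_def pmaj_word_def)
    then have "j \<noteq> 0" if "word j \<le> word (Suc j)" for j using that by (cases j) auto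
    then show ?thesis by (force simp: Suc_le_eq)
  qed
  ultimately show ?thesis using r(2) by (simp add: lab_pmaj_def m_def[symmetric])
qed

end
section \<open>East steps and the north steps that own them\<close>

context parking
begin

text \<open>The ordinate of the east step from \<open>x = c\<close> to \<open>x = c + 1\<close>.\<close>

definition row :: "nat \<Rightarrow> nat" where
  "row c = card {l \<in> {1..n}. x l \<le> c}"

lemma row_le: "row c \<le> n"
proof -
  have "card {l \<in> {1..n}. x l \<le> c} \<le> card {1..n}" by (intro card_mono) auto
  then show ?thesis by (simp add: row_def)
qed

lemma x_mono': "l \<in> {1..n} \<Longrightarrow> m \<in> {1..n} \<Longrightarrow> y l \<le> y m \<Longrightarrow> x l \<le> x m"
  using x_mono[of l m] y_inj[of l m] by (cases "y l = y m") auto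

lemma y_less_row_iff:
  assumes l: "l \<in> {1..n}"
  shows "y l < row c \<longleftrightarrow> x l \<le> c"
proof
  assume "x l \<le> c"
  then have "{u \<in> {1..n}. y u < Suc (y l)} \<subseteq> {u \<in> {1..n}. x u \<le> c}"
    using x_mono'[OF _ l] by fastforce
  then have "card {u \<in> {1..n}. y u < Suc (y l)} \<le> row c"
    unfolding row_def by (intro card_mono) simp_all
  then show "y l < row c" using card_y_less[of "Suc (y l)"] y_less[OF l] by simp
next
  assume *: "y l < row c"
  show "x l \<le> c"
  proof (rule ccontr)
    assume "\<not> x l \<le> c"
    then have "{u \<in> {1..n}. x u \<le> c} \<subseteq> {u \<in> {1..n}. y u < y l}"
      using x_mono'[OF l] by fastforce
    then have "row c \<le> card {u \<in> {1..n}. y u < y l}"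
      unfolding row_def by (intro card_mono) simp_all
    then show False using card_y_less[of "y l"] y_less[OF l] * by simp
  qed
qed

text \<open>The height of the starting point of the east step from \<open>x = c\<close> to \<open>x = c + 1\<close>; the step descends
from this height by one.\<close>

definition level :: "nat \<Rightarrow> nat" where
  "level c = k * row c - c"

lemma level_eq:
  assumes "c < k * n"
  shows "level c + c = k * row c" "level c > 0"
proof -
  have "c < k * row c"
  proof (cases "row c < n")
    case True
    then obtain l where l: "l \<in> {1..n}" "y l = row c" by (rule y_surj)
    then have "c < x l" using y_less_row_iff[of l c] by simp
    then show ?thesis using x_le[OF l(1)] l by simp
  next
    case False
    then show ?thesis using row_le[of c] assms by simp
  qed
  then show "level c + c = k * row c" "level c > 0" by (simp_all add: level_def)
qed

text \<open>The last north step before the east step at \<open>x = c\<close> that starts below the height of the east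
step. Reading north steps as \<open>k\<close> opening brackets and east steps as closing ones, it is the step
that matches the east step.\<close>

definition owner :: "nat \<Rightarrow> nat \<Rightarrow> bool" where
  "owner l c \<longleftrightarrow> l \<in> {1..n} \<and> x l \<le> c \<and> ht l < level c \<and>
     (\<forall>m \<in> {1..n}. y l < y m \<longrightarrow> x m \<le> c \<longrightarrow> level c \<le> ht m)"

lemma owner_exists:
  assumes c: "c < k * n"
  shows "\<exists>l. owner l c"
proof -
  define A where "A = {u \<in> {1..n}. x u \<le> c \<and> ht u < level c}"
  have "row c > 0" using level_eq[OF c] by (cases "row c") auto
  moreover from this have "0 < n" using row_le[of c] by simp
  then obtain w where w: "w \<in> {1..n}" "y w = 0" by (rule y_surj)
  moreover have "ht w = 0" "x w = 0" using ht_eq[of w] w by auto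
  ultimately have "w \<in> A" using level_eq[OF c] by (simp add: A_def)
  then have fin: "finite (y ` A)" "y ` A \<noteq> {}" by (auto simp: A_def)
  obtain l where l: "l \<in> A" "y l = Max (y ` A)"
    using Max_in[OF fin] by (metis imageE)
  have "owner l c"
    unfolding owner_def
  proof (intro conjI ballI impI)
    fix m assume m: "m \<in> {1..n}" "y l < y m" "x m \<le> c"
    show "level c \<le> ht m"
    proof (rule ccontr)
      assume "\<not> level c \<le> ht m"
      then have "m \<in> A" using m by (simp add: A_def)
      then have "y m \<le> y l" using l(2) fin(1) by simp
      then show False using m by simp
    qed
  qed (use l in \<open>auto simp: A_def\<close>)
  then show ?thesis ..
qed

text \<open>The owner raises the path by \<open>k\<close>, to at least the height of the next north step. If that step
comes before the east step, it starts at height \<open>level c\<close> or above; otherwise the path goes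
straight east from the owner to the east step.\<close>

lemma owner_level_le:
  assumes c: "c < k * n" and l: "owner l c"
  shows "level c \<le> ht l + k"
proof -
  have l': "l \<in> {1..n}" "x l \<le> c" using l by (auto simp: owner_def)
  then have less: "y l < row c" using y_less_row_iff by simp
  show ?thesis
  proof (cases "Suc (y l) = row c")
    case True
    then have "k * row c = k * y l + k" by (metis mult_Suc_right add.commute)
    then show ?thesis using level_eq(1)[OF c] ht_eq[OF l'(1)] l'(2) by linarith
  next
    case False
    then have next_less: "Suc (y l) < row c" using less by simp
    then have "Suc (y l) < n" using row_le[of c] by simp
    then obtain v where v: "v \<in> {1..n}" "y v = Suc (y l)" by (rule y_surj)
    then have "x v \<le> c" using next_less y_less_row_iff[of v c] by simp
    then have "level c \<le> ht v" using l v unfolding owner_def by simp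
    then show ?thesis using successor_ht(1)[OF l'(1) v] by simp
  qed
qed

text \<open>If \<open>l\<close> owned two steps of equal height, then the north step right after the first of them would
start below that height, between \<open>l\<close> and the second one.\<close>

lemma owner_level_inj:
  assumes "c < d" "d < k * n" "owner l c" "owner l d"
  shows "level c \<noteq> level d"
proof
  assume eq: "level c = level d"
  have c: "level c + c = k * row c" and d: "level d + d = k * row d"
    using level_eq(1) assms by simp_all
  then have "k * row c < k * row d" using eq assms(1) by linarith
  then have less: "row c < row d" by simp
  then have "row c < n" using row_le[of d] by simp
  then obtain m where m: "m \<in> {1..n}" "y m = row c" by (rule y_surj)
  have l: "l \<in> {1..n}" "x l \<le> c" using assms by (auto simp: owner_def)
  then have "y l < y m" using y_less_row_iff m by simp
  moreover have "c < x m" using y_less_row_iff[OF m(1), of c] m by simp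
  moreover have "x m \<le> d" using y_less_row_iff[OF m(1), of d] m less by simp
  ultimately have "level d \<le> ht m" using assms(4) m unfolding owner_def by blast
  then show False using ht_eq[OF m(1)] m c \<open>c < x m\<close> eq by simp
qed

text \<open>The path is at height \<open>h\<close> or above after the step \<open>l\<close>, and below \<open>h\<close> when the first later
north step \<open>v\<close> with \<open>ht v < h\<close> begins. The east step that descends from \<open>h\<close> therefore lies on
the horizontal line of the lower endpoint of \<open>v\<close>.\<close>

lemma owned_step_exists:
  assumes lm: "l \<in> {1..n}" "m \<in> {1..n}" "y l < y m"
    and h: "ht l < h" "h \<le> ht l + k" "ht m < h"
  shows "\<exists>c. c < k * n \<and> c < x m \<and> owner l c \<and> level c = h"
proof -
  define i where "i = (LEAST i. \<exists>v \<in> {1..n}. y v = i \<and> y l < y v \<and> ht v < h)"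
  have ex: "\<exists>v \<in> {1..n}. y v = y m \<and> y l < y v \<and> ht v < h" using lm h by blast
  obtain v where v: "v \<in> {1..n}" "y v = i" "y l < y v" "ht v < h"
    using LeastI[of "\<lambda>i. \<exists>v \<in> {1..n}. y v = i \<and> y l < y v \<and> ht v < h", OF ex] unfolding i_def by blast
  have i_le: "i \<le> y m" unfolding i_def using ex by (rule Least_le)
  have below: "h \<le> ht u" if u: "u \<in> {1..n}" "y l < y u" "y u < i" for u
    using not_less_Least[of "y u" "\<lambda>i. \<exists>v \<in> {1..n}. y v = i \<and> y l < y v \<and> ht v < h"] u
    unfolding i_def by fastforce
  have "Suc (y l) \<le> i" using v by simp
  then have k_i: "k * y l + k \<le> k * i" using mult_le_mono2[of "Suc (y l)" i k] by simp
  define c where "c = k * i - h"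
  have c: "c + h = k * i" using k_i h ht_eq[OF lm(1)] unfolding c_def by linarith
  have cv: "c < x v" using ht_eq[OF v(1)] v c by simp
  have x_c: "x u \<le> c" if u: "u \<in> {1..n}" "y u < i" for u
  proof -
    have "i - 1 < n" using v y_less[OF v(1)] by simp
    then obtain w where w: "w \<in> {1..n}" "y w = i - 1" by (rule y_surj)
    have "x u \<le> x w" using x_mono'[OF u(1) w(1)] u w by simp
    also have "x w \<le> c"
    proof (cases "y w = y l")
      case True
      then have "w = l" using y_inj[OF w(1) lm(1)] by simp
      moreover have "x l \<le> c" using ht_eq[OF lm(1)] h c k_i by linarith
      ultimately show ?thesis by simp
    next
      case False
      then have wi: "y l < y w" "y w < i" using w v by simp_all
      then have "h \<le> ht w" using below w by blast
      moreover have "i = Suc (y w)" using w wi by simp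
      then have "k * i = k * y w + k" by simp
      ultimately show ?thesis using ht_eq[OF w(1)] c by linarith
    qed
    finally show ?thesis .
  qed
  have "row c = i"
  proof -
    have "x u \<le> c \<longleftrightarrow> y u < i" if "u \<in> {1..n}" for u
      using x_c[OF that] x_mono'[OF v(1) that] cv v by fastforce
    then have "{u \<in> {1..n}. x u \<le> c} = {u \<in> {1..n}. y u < i}" by blast
    then show ?thesis using card_y_less[of i] y_less[OF v(1)] v by (simp add: row_def)
  qed
  then have level: "level c = h" using c by (simp add: level_def)
  have "x v \<le> x m" using x_mono'[OF v(1) lm(2)] v i_le by simp
  then have "c < x m" using cv by simp
  moreover have "x m < k * n"
  proof -
    have "x m < k * Suc (y m)" using x_le[OF lm(2)] k_pos by simp
    also have "\<dots> \<le> k * n" using y_less[OF lm(2)] by (intro mult_le_mono2) simp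
    finally show ?thesis .
  qed
  moreover have "owner l c"
    unfolding owner_def level
  proof (intro conjI ballI impI)
    show "x l \<le> c" using x_c[OF lm(1)] v by simp
    show "h \<le> ht u" if "u \<in> {1..n}" "y l < y u" "x u \<le> c" for u
      using below[OF that(1,2)] y_less_row_iff[OF that(1), of c] that \<open>row c = i\<close> by simp
  qed (use lm h in simp_all)
  ultimately show ?thesis using level by (intro exI[of _ c]) simp
qed

text \<open>For \<open>p\<close> before \<open>q\<close>, the number of east steps owned by \<open>p\<close> inside the shadow of \<open>q\<close>, counted by
their heights. The interval for \<open>q\<close> begins at \<open>ht q + 2\<close> because also the endpoint of the east
step, one lower, must lie strictly above the lower boundary of the shadow.\<close>

definition corr :: "nat \<Rightarrow> nat \<Rightarrow> nat" where
  "corr p q = card {h. ht p < h \<and> h \<le> ht p + k \<and> ht q + 2 \<le> h \<and> h \<le> ht q + k}"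

lemma card_owned_steps:
  assumes p: "p \<in> {1..n}" and q: "q \<in> {1..n}"
  shows "card {c. c < k * n \<and> owner p c \<and> c < x q \<and> ht q + 2 \<le> level c \<and> level c \<le> ht q + k} =
    (if y p < y q then corr p q else 0)" (is "card ?C = _")
proof (cases "y p < y q")
  case True
  let ?H = "{h. ht p < h \<and> h \<le> ht p + k \<and> ht q + 2 \<le> h \<and> h \<le> ht q + k}"
  have "level ` ?C = ?H"
  proof
    show "level ` ?C \<subseteq> ?H" using owner_level_le by (auto simp: owner_def)
    show "?H \<subseteq> level ` ?C"
    proof
      fix h assume h: "h \<in> ?H"
      then obtain c where "c < k * n" "c < x q" "owner p c" "level c = h"
        using owned_step_exists[OF p q True, of h] by auto
      then show "h \<in> level ` ?C" using h by blast
    qed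
  qed
  moreover have "inj_on level ?C"
  proof (rule inj_onI)
    fix c d assume cd: "c \<in> ?C" "d \<in> ?C" "level c = level d"
    then show "c = d"
      using owner_level_inj[of c d p] owner_level_inj[of d c p] by (cases c d rule: linorder_cases) auto
  qed
  ultimately show ?thesis using True card_image[of level ?C] by (simp add: corr_def)
next
  case False
  then have "x q \<le> x p" using x_mono'[OF q p] by simp
  then have "?C = {}" by (auto simp: owner_def)
  then show ?thesis using False by simp
qed

section \<open>Multiplicities of pairs in Dinv\<close>

definition tdinv :: "nat \<Rightarrow> nat \<Rightarrow> bool" where
  "tdinv p q \<longleftrightarrow> p < q \<and> ht q < ht p + k \<and> ht p \<le> ht q \<or> q < p \<and> ht q < ht p \<and> ht p \<le> ht q + k"

definition dinv_mult :: "nat \<Rightarrow> nat \<Rightarrow> nat" where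
  "dinv_mult p q = (if y p < y q then of_bool (tdinv p q) + corr p q else 0)"

text \<open>The order of the diagonal reading word.\<close>

definition before :: "nat \<Rightarrow> nat \<Rightarrow> bool" where
  "before u l \<longleftrightarrow> ht u < ht l \<or> ht u = ht l \<and> y u < y l"

text \<open>The neighbours to the right of \<open>l\<close>. Each of them moves the step \<open>l\<close> of the image one unit to
the left of the last position that is compatible with first pass \<open>ht l\<close>.\<close>

definition blocked :: "nat \<Rightarrow> nat set" where
  "blocked l = {u \<in> nbrs n k ht l. y l < y u}"

lemma corr_eq: "corr p q = Suc (min (ht p + k) (ht q + k)) - max (Suc (ht p)) (ht q + 2)"
proof -
  have "{h. ht p < h \<and> h \<le> ht p + k \<and> ht q + 2 \<le> h \<and> h \<le> ht q + k} =
    {max (Suc (ht p)) (ht q + 2)..min (ht p + k) (ht q + k)}" by auto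
  then show ?thesis unfolding corr_def by simp
qed

text \<open>With \<open>e = ht l - ht u\<close>, the two multiplicities add up to \<open>k - e - 1\<close>, plus one if \<open>u < l\<close>, plus
one if \<open>l\<close> is to the left of \<open>u\<close>, cut off at zero. The number of copies of \<open>u\<close> before slot
\<open>(ht l, l)\<close> is \<open>e\<close>, plus one if \<open>l < u\<close>, cut off at \<open>k\<close>. So the sum is \<open>k\<close> up to the
contribution of \<open>l\<close> being to the left of \<open>u\<close>. That contribution survives the cut-off iff the
number of copies does not exceed \<open>k\<close> before its own cut-off, which is the condition for \<open>u\<close> to be
a neighbour.\<close>

lemma dinv_mult_before:
  assumes u: "u \<in> {1..n}" and l: "l \<in> {1..n}" and before: "before u l"
  shows "dinv_mult u l + dinv_mult l u + copies k ht (ht l) (Suc l) u = k + of_bool (u \<in> blocked l)"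
proof -
  have ne: "u \<noteq> l" using before by (auto simp: before_def)
  have blocked: "u \<in> blocked l \<longleftrightarrow> y l < y u \<and>
      (l < u \<and> ht u \<le> ht l \<and> ht l < ht u + k \<or> u < l \<and> ht u < ht l \<and> ht l \<le> ht u + k)"
    using u by (auto simp: blocked_def nbrs_def)
  have le: "ht u \<le> ht l" using before by (auto simp: before_def)
  consider "y u < y l" | "y l < y u" "ht u < ht l"
    using before y_inj[OF u l] ne unfolding before_def by linarith
  then show ?thesis
  proof cases
    case 1
    then have "dinv_mult l u = 0" "\<not> u \<in> blocked l" using blocked by (auto simp: dinv_mult_def)
    moreover have "dinv_mult u l + copies k ht (ht l) (Suc l) u = k"
      using 1 le ne k_pos by (auto simp: dinv_mult_def corr_eq copies_def tdinv_def min_def max_def)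
    ultimately show ?thesis by simp
  next
    case 2
    then have "dinv_mult u l = 0" by (simp add: dinv_mult_def)
    moreover have "dinv_mult l u + copies k ht (ht l) (Suc l) u = k + of_bool (u \<in> blocked l)"
      unfolding blocked
      using 2 ne k_pos by (auto simp: dinv_mult_def corr_eq copies_def tdinv_def min_def max_def)
    ultimately show ?thesis by simp
  qed
qed

text \<open>A label that does not precede \<open>l\<close> in the reading word has a copy before slot \<open>(ht l, l)\<close> only
if it has the height of \<open>l\<close>, is larger than \<open>l\<close> and lies to the right of \<open>l\<close>. Then it has one such
copy and is blocked, so it contributes nothing to the difference of the two counts.\<close>

lemma copies_not_before:
  assumes u: "u \<in> {1..n}" and l: "l \<in> {1..n}" and "\<not> before u l"
  shows "copies k ht (ht l) (Suc l) u = of_bool (u \<in> blocked l)"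
proof (cases "u = l")
  case True
  then show ?thesis by (simp add: copies_def blocked_def)
next
  case False
  then have "ht l < ht u \<or> ht u = ht l \<and> y l < y u"
    using assms y_inj[OF u l] by (auto simp: before_def)
  then show ?thesis
    using False u k_pos by (auto simp: copies_def blocked_def nbrs_def)
qed

lemma sum_dinv_mult:
  assumes l: "l \<in> {1..n}"
  shows "(\<Sum>u \<in> {u \<in> {1..n}. before u l}. dinv_mult u l + dinv_mult l u) +
      (\<Sum>u = 1..n. copies k ht (ht l) (Suc l) u) =
    k * card {u \<in> {1..n}. before u l} + card (blocked l)"
proof -
  let ?B = "{u \<in> {1..n}. before u l}"
  let ?c = "copies k ht (ht l) (Suc l)"
  have split: "{1..n} = ?B \<union> {u \<in> {1..n}. \<not> before u l}" by blast
  have sum_split: "sum f {1..n} = sum f ?B + sum f {u \<in> {1..n}. \<not> before u l}" for f :: "nat \<Rightarrow> nat"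
    by (subst split, subst sum.union_disjoint) auto
  have "(\<Sum>u \<in> ?B. dinv_mult u l + dinv_mult l u) + sum ?c {1..n} =
      (\<Sum>u \<in> ?B. dinv_mult u l + dinv_mult l u + ?c u) + sum ?c {u \<in> {1..n}. \<not> before u l}"
    unfolding sum_split[of ?c] by (simp add: sum.distrib)
  also have "(\<Sum>u \<in> ?B. dinv_mult u l + dinv_mult l u + ?c u) = (\<Sum>u \<in> ?B. k + of_bool (u \<in> blocked l))"
    by (intro sum.cong refl dinv_mult_before) (use l in auto)
  also have "sum ?c {u \<in> {1..n}. \<not> before u l} = (\<Sum>u \<in> {u \<in> {1..n}. \<not> before u l}. of_bool (u \<in> blocked l))"
    by (intro sum.cong refl copies_not_before) (use l in auto)
  also have "(\<Sum>u \<in> ?B. k + of_bool (u \<in> blocked l)) + \<dots> =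
      k * card ?B + (\<Sum>u = 1..n. of_bool (u \<in> blocked l))"
    unfolding sum_split[of "\<lambda>u. of_bool (u \<in> blocked l)"] by (simp add: sum.distrib)
  also have "(\<Sum>u = 1..n. of_bool (u \<in> blocked l)) = card (blocked l)"
    by (rule sum_of_bool_subset) (auto simp: blocked_def nbrs_def)
  finally show ?thesis .
qed

text \<open>The letters before slot \<open>(ht l, l)\<close> less the blocked neighbours. By \<open>lab_dinv_image_xpos\<close> this is the
abscissa of the north step \<open>l\<close> in the image under \<open>phi\<close>.\<close>

definition image_xpos :: "nat \<Rightarrow> nat" where
  "image_xpos l = (\<Sum>u = 1..n. copies k ht (ht l) (Suc l) u) - card (blocked l)"

text \<open>The neighbours are exactly the labels used between the two slots.\<close>

lemma sum_copies_step:
  assumes "ht l = Suc r"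
  shows "(\<Sum>u = 1..n. copies k ht (ht l) (Suc l) u) =
    (\<Sum>u = 1..n. copies k ht r (Suc l) u) + card (nbrs n k ht l)"
proof -
  have "copies k ht (ht l) (Suc l) u = copies k ht r (Suc l) u + of_bool (u \<in> nbrs n k ht l)"
    if "u \<in> {1..n}" for u
  proof -
    have "u \<in> nbrs n k ht l \<longleftrightarrow>
        (l < u \<and> ht u \<le> Suc r \<and> Suc r < ht u + k \<or> u < l \<and> ht u < Suc r \<and> Suc r \<le> ht u + k)"
      using that assms by (auto simp: nbrs_def)
    moreover have "u = l \<Longrightarrow> copies k ht (Suc r) (Suc l) u = copies k ht r (Suc l) u"
      using assms by (simp add: copies_def)
    ultimately show ?thesis unfolding assms
      by (cases u l rule: linorder_cases) (auto simp: copies_def min_def)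
  qed
  then have "(\<Sum>u = 1..n. copies k ht (ht l) (Suc l) u) =
      (\<Sum>u = 1..n. copies k ht r (Suc l) u + of_bool (u \<in> nbrs n k ht l))"
    by (intro sum.cong refl) auto
  also have "\<dots> = (\<Sum>u = 1..n. copies k ht r (Suc l) u) + (\<Sum>u = 1..n. of_bool (u \<in> nbrs n k ht l))"
    by (rule sum.distrib)
  also have "(\<Sum>u = 1..n. of_bool (u \<in> nbrs n k ht l)) = card (nbrs n k ht l)"
    by (rule sum_of_bool_subset) (auto simp: nbrs_def)
  finally show ?thesis .
qed

lemma card_blocked_le: "card (blocked l) \<le> (\<Sum>u = 1..n. copies k ht (ht l) (Suc l) u)"
proof -
  have "of_bool (u \<in> blocked l) \<le> copies k ht (ht l) (Suc l) u" for u
    using k_pos by (auto simp: blocked_def nbrs_def copies_def)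
  then have "(\<Sum>u = 1..n. of_bool (u \<in> blocked l)) \<le> (\<Sum>u = 1..n. copies k ht (ht l) (Suc l) u)"
    by (intro sum_mono)
  moreover have "(\<Sum>u = 1..n. of_bool (u \<in> blocked l)) = card (blocked l)"
    by (rule sum_of_bool_subset) (auto simp: blocked_def nbrs_def)
  ultimately show ?thesis by simp
qed

text \<open>Not all neighbours are blocked, by \<open>nbr_left\<close>.\<close>

lemma image_xpos_gt:
  assumes l: "l \<in> {1..n}" and r: "ht l = Suc r"
  shows "(\<Sum>u = 1..n. copies k ht r (Suc l) u) < image_xpos l"
proof -
  obtain v where v: "v \<in> nbrs n k ht l" "y v < y l" using nbr_left[OF l] r by auto
  then have "v \<notin> blocked l" by (simp add: blocked_def)
  moreover have "blocked l \<subseteq> nbrs n k ht l" unfolding blocked_def by blast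
  ultimately have "blocked l \<subset> nbrs n k ht l" using v(1) by blast
  then have "card (blocked l) < card (nbrs n k ht l)"
    by (rule psubset_card_mono[OF finite_nbrs])
  then show ?thesis unfolding image_xpos_def sum_copies_step[OF r] by simp
qed

end
section \<open>Parking functions as paths\<close>

lemma path_append_simps [simp]:
  "easts (D @ E) = easts D + easts E"
  "norths (D @ E) = norths D + norths E"
  "labels (D @ E) = labels D @ labels E"
  by (simp_all add: easts_def norths_def labels_def)

lemma path_Cons_simps [simp]:
  "easts [] = 0" "easts (East # D) = Suc (easts D)" "easts (North l # D) = easts D"
  "norths [] = 0" "norths (East # D) = norths D" "norths (North l # D) = Suc (norths D)"
  "labels [] = []" "labels (East # D) = labels D" "labels (North l # D) = l # labels D"
  by (simp_all add: easts_def norths_def labels_def)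

lemma length_labels: "length (labels D) = norths D"
  by (simp add: labels_def norths_def)

lemma in_labels_iff: "l \<in> set (labels D) \<longleftrightarrow> North l \<in> set D"
proof (induction D)
  case (Cons s D)
  then show ?case by (cases s) auto
qed simp

lemma take_split:
  assumes "p \<le> q"
  shows "take q D = take p D @ take (q - p) (drop p D)"
  using assms take_add[of p "q - p" D] by simp

lemma easts_take_mono: "p \<le> q \<Longrightarrow> easts (take p D) \<le> easts (take q D)"
  by (simp add: take_split[of p q D])

lemma norths_take_mono: "p \<le> q \<Longrightarrow> norths (take p D) \<le> norths (take q D)"
  by (simp add: take_split[of p q D])

lemma easts_take_less:
  assumes "p < q" "q \<le> length D" "D ! p = East"
  shows "easts (take p D) < easts (take q D)"
proof -
  have "easts (take (Suc p) D) = Suc (easts (take p D))"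
    using assms by (simp add: take_Suc_conv_app_nth)
  then show ?thesis using easts_take_mono[of "Suc p" q D] assms by simp
qed

lemma norths_take_less:
  assumes "p < q" "q \<le> length D" "D ! p = North l"
  shows "norths (take p D) < norths (take q D)"
proof -
  have "norths (take (Suc p) D) = Suc (norths (take p D))"
    using assms by (simp add: take_Suc_conv_app_nth)
  then show ?thesis using norths_take_mono[of "Suc p" q D] assms by simp
qed

lemma labels_nth:
  assumes "p < length D" "D ! p = North l"
  shows "norths (take p D) < norths D" "labels D ! norths (take p D) = l"
proof -
  have D: "D = take p D @ North l # drop (Suc p) D"
    using assms id_take_nth_drop by metis
  then have "labels D = labels (take p D) @ l # labels (drop (Suc p) D)"
    by (metis path_append_simps(3) path_Cons_simps(9))
  then show "labels D ! norths (take p D) = l"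
    by (metis length_labels nth_append_length)
  show "norths (take p D) < norths D"
    using norths_take_less[OF assms(1) order_refl assms(2)] by simp
qed

lemma east_step_exists:
  "c < easts D \<Longrightarrow> \<exists>p < length D. D ! p = East \<and> easts (take p D) = c"
proof (induction D rule: rev_induct)
  case (snoc s D)
  show ?case
  proof (cases "c < easts D")
    case True
    then obtain p where "p < length D" "D ! p = East" "easts (take p D) = c"
      using snoc.IH by blast
    then show ?thesis by (intro exI[of _ p]) (simp add: nth_append)
  next
    case False
    then show ?thesis using snoc.prems by (intro exI[of _ "length D"]) (cases s, auto)
  qed
qed simp

locale parking_function =
  fixes n k :: nat and D :: path
  assumes k_ge_1: "k \<ge> 1" and mem: "D \<in> PF n k"
begin

definition pos :: "nat \<Rightarrow> nat" where
  "pos l = length (takeWhile (\<lambda>s. s \<noteq> North l) D)"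

lemma easts_D: "easts D = k * n"
  using mem by (simp add: PF_def)

lemma distinct_labels: "distinct (labels D)"
  using mem by (simp add: PF_def)

lemma set_labels: "set (labels D) = {1..n}"
  using mem by (simp add: PF_def)

lemma norths_D: "norths D = n"
  using distinct_card[OF distinct_labels] by (simp add: set_labels length_labels)

lemma above_diagonal: "p \<le> length D \<Longrightarrow> easts (take p D) \<le> k * norths (take p D)"
  using mem by (simp add: PF_def)

lemma increasing:
  "p < q \<Longrightarrow> q < length D \<Longrightarrow> D ! p = North l \<Longrightarrow> D ! q = North m \<Longrightarrow>
    easts (take p D) = easts (take q D) \<Longrightarrow> l < m"
  using mem unfolding PF_def by blast

lemma pos:
  assumes "l \<in> {1..n}"
  shows "pos l < length D" "D ! pos l = North l"
    "xpos D l = easts (take (pos l) D)" "ypos D l = norths (take (pos l) D)"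
proof -
  have "North l \<in> set D" using assms set_labels in_labels_iff by metis
  then have "takeWhile (\<lambda>s. s \<noteq> North l) D \<noteq> D"
    using takeWhile_eq_all_conv[of "\<lambda>s. s \<noteq> North l" D] by blast
  then show less: "pos l < length D"
    unfolding pos_def by (metis length_takeWhile_le le_neq_implies_less takeWhile_eq_take take_all order_refl)
  show "D ! pos l = North l"
    using nth_length_takeWhile[of "\<lambda>s. s \<noteq> North l" D] less unfolding pos_def by blast
  show "xpos D l = easts (take (pos l) D)" "ypos D l = norths (take (pos l) D)"
    unfolding xpos_def ypos_def pos_def by (simp_all flip: takeWhile_eq_take)
qed

lemma labels_ypos: "l \<in> {1..n} \<Longrightarrow> labels D ! ypos D l = l"
  using labels_nth(2) pos by metis

lemma ypos_less: "l \<in> {1..n} \<Longrightarrow> ypos D l < n"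
  using labels_nth(1) pos norths_D by metis

lemma pos_unique:
  assumes "p < length D" "D ! p = North l"
  shows "l \<in> {1..n}" "p = pos l"
proof -
  have "l \<in> set (labels D)" using labels_nth[OF assms] length_labels nth_mem by metis
  then show l: "l \<in> {1..n}" using set_labels by simp
  show "p = pos l"
  proof (rule ccontr)
    assume "p \<noteq> pos l"
    then have "norths (take p D) \<noteq> norths (take (pos l) D)"
      using norths_take_less[of p "pos l" D l] norths_take_less[of "pos l" p D l] pos[OF l] assms
      by (cases "p < pos l") auto
    moreover have "labels D ! norths (take p D) = labels D ! norths (take (pos l) D)"
      using labels_nth[OF assms] labels_nth[OF pos(1,2)[OF l]] by simp
    ultimately show False
      using nth_eq_iff_index_eq[OF distinct_labels] labels_nth(1)[OF assms]
        labels_nth(1)[OF pos(1,2)[OF l]] length_labels by metis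
  qed
qed

lemma ypos_less_iff:
  assumes "l \<in> {1..n}" "m \<in> {1..n}"
  shows "ypos D l < ypos D m \<longleftrightarrow> pos l < pos m"
  using norths_take_less[of "pos l" "pos m" D l] norths_take_mono[of "pos m" "pos l" D]
    pos[OF assms(1)] pos[OF assms(2)] by (cases "pos l < pos m") auto

sublocale parking n k "xpos D" "ypos D"
proof
  show "bij_betw (ypos D) {1..n} {..<n}"
  proof (rule bij_betw_imageI)
    show inj: "inj_on (ypos D) {1..n}"
      using labels_ypos by (rule inj_on_inverseI)
    have "ypos D ` {1..n} \<subseteq> {..<n}" using ypos_less by blast
    then show "ypos D ` {1..n} = {..<n}"
      using card_image[OF inj] by (intro card_subset_eq) simp_all
  qed
next
  fix l m assume lm: "l \<in> {1..n}" "m \<in> {1..n}" "ypos D l < ypos D m"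
  then have less: "pos l < pos m" using ypos_less_iff by simp
  then show "xpos D l \<le> xpos D m"
    using easts_take_mono[of "pos l" "pos m" D] pos(3) lm by simp
  assume "xpos D l = xpos D m"
  then show "l < m" using increasing[OF less] pos lm by simp
next
  fix l assume "l \<in> {1..n}"
  then show "xpos D l \<le> k * ypos D l" using above_diagonal[of "pos l"] pos[of l] by simp
qed (rule k_ge_1)

end

section \<open>Paths and their columns\<close>

text \<open>Each step is coded by its abscissa and its label as the digits of a number in base \<open>n + 2\<close>, where
\<open>n + 1\<close> stands for the label of an east step. Path order is then the order of numbers, because an
east step comes last on its vertical line and north steps are sorted by label.\<close>

definition keys :: "nat \<Rightarrow> nat \<Rightarrow> (nat \<Rightarrow> nat) \<Rightarrow> nat set" where
  "keys n k x = (\<lambda>l. x l * (n + 2) + l) ` {1..n} \<union> (\<lambda>c. c * (n + 2) + (n + 1)) ` {..<k * n}"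

definition step_of :: "nat \<Rightarrow> nat \<Rightarrow> step" where
  "step_of n z = (if z mod (n + 2) = n + 1 then East else North (z mod (n + 2)))"

lemma div_mod_key:
  fixes c l n :: nat
  assumes "l \<le> n + 1"
  shows "(c * (n + 2) + l) div (n + 2) = c" "(c * (n + 2) + l) mod (n + 2) = l"
proof -
  have "(l + c * (n + 2)) div (n + 2) = c + l div (n + 2)"
    by (rule div_mult_self1) simp
  then show "(c * (n + 2) + l) div (n + 2) = c" using assms by (simp add: add.commute)
  have "(l + c * (n + 2)) mod (n + 2) = l mod (n + 2)" by (rule mod_mult_self1)
  then show "(c * (n + 2) + l) mod (n + 2) = l"
    using assms by (simp add: add.commute del: mult_Suc_right)
qed

lemma key_less:
  fixes c d l m n :: nat
  assumes "l \<le> n + 1" "c < d \<or> c = d \<and> l < m"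
  shows "c * (n + 2) + l < d * (n + 2) + m"
proof (cases "c < d")
  case True
  then have "Suc c * (n + 2) \<le> d * (n + 2)" by (intro mult_le_mono1) simp
  then show ?thesis using assms by simp
qed (use assms in auto)

lemma finite_keys: "finite (keys n k x)"
  by (simp add: keys_def)

context parking_function
begin

lemma path_eq: "D = map (step_of n) (sorted_list_of_set (keys n k (xpos D)))"
proof -
  define code where "code s = (case s of North l \<Rightarrow> l | East \<Rightarrow> n + 1)" for s
  define key where "key p = easts (take p D) * (n + 2) + code (D ! p)" for p
  define K where "K = map key [0..<length D]"
  have code_le: "code (D ! p) \<le> n + 1" if "p < length D" for p
    using pos_unique(1)[OF that] by (auto simp: code_def split: step.splits)
  have "key p < key q" if pq: "p < q" "q < length D" for p q
  proof -
    have "easts (take p D) < easts (take q D) \<or>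
        easts (take p D) = easts (take q D) \<and> code (D ! p) < code (D ! q)"
    proof (cases "D ! p")
      case East
      then show ?thesis using easts_take_less[of p q D] pq by simp
    next
      case (North l)
      then have l: "l \<in> {1..n}" using pos_unique(1)[of p l] pq by simp
      show ?thesis
      proof (cases "easts (take p D) = easts (take q D)")
        case True
        then show ?thesis using increasing[OF pq North] l North
          by (cases "D ! q") (auto simp: code_def)
      next
        case False
        then show ?thesis using easts_take_mono[of p q D] pq by simp
      qed
    qed
    then show ?thesis unfolding key_def using code_le pq by (intro key_less) auto
  qed
  then have sorted: "sorted_wrt (<) K"
    by (auto simp: K_def sorted_wrt_iff_nth_less)
  have "set K = keys n k (xpos D)"
  proof
    show "set K \<subseteq> keys n k (xpos D)"
    proof
      fix z assume "z \<in> set K"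
      then obtain p where p: "p < length D" "z = key p" by (auto simp: K_def)
      show "z \<in> keys n k (xpos D)"
      proof (cases "D ! p")
        case East
        then have "easts (take p D) < k * n"
          using easts_take_less[OF p(1) order_refl] easts_D by simp
        moreover have "z = easts (take p D) * (n + 2) + (n + 1)"
          using p East by (simp add: key_def code_def)
        ultimately show ?thesis unfolding keys_def by blast
      next
        case (North l)
        then have l: "l \<in> {1..n}" "p = pos l" using pos_unique p by auto
        then have "z = xpos D l * (n + 2) + l"
          using p North pos(3)[OF l(1)] by (simp add: key_def code_def)
        then show ?thesis using l(1) unfolding keys_def by blast
      qed
    qed
    show "keys n k (xpos D) \<subseteq> set K"
    proof
      fix z assume "z \<in> keys n k (xpos D)"
      then consider l where "l \<in> {1..n}" "z = xpos D l * (n + 2) + l"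
        | c where "c < k * n" "z = c * (n + 2) + (n + 1)" by (auto simp: keys_def)
      then show "z \<in> set K"
      proof cases
        case 1
        then have "z = key (pos l)" using pos[of l] by (simp add: key_def code_def)
        then show ?thesis using pos(1)[OF 1(1)] by (simp add: K_def)
      next
        case 2
        then obtain p where "p < length D" "D ! p = East" "easts (take p D) = c"
          using east_step_exists[of c D] easts_D by auto
        then have "z = key p" "p < length D" using 2 by (simp_all add: key_def code_def)
        then show ?thesis by (simp add: K_def)
      qed
    qed
  qed
  then have "K = sorted_list_of_set (keys n k (xpos D))"
    using sorted strict_sorted_list_of_set[of "keys n k (xpos D)"] finite_keys
    by (intro strict_sorted_equal) auto
  moreover have "D = map (step_of n) K"
  proof (rule nth_equalityI)
    fix p assume p: "p < length D"
    have "code (D ! p) = key p mod (n + 2)"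
      unfolding key_def using div_mod_key(2)[OF code_le[OF p]] by simp
    then have "step_of n (key p) = (if code (D ! p) = n + 1 then East else North (code (D ! p)))"
      by (simp add: step_of_def)
    then show "D ! p = map (step_of n) K ! p"
      using p pos_unique(1)[OF p] by (cases "D ! p") (auto simp: K_def code_def)
  qed (simp add: K_def)
  ultimately show ?thesis by simp
qed

end

lemma PF_eqI:
  assumes "k \<ge> 1" "D \<in> PF n k" "E \<in> PF n k" "\<And>l. l \<in> {1..n} \<Longrightarrow> xpos D l = xpos E l"
  shows "D = E"
proof -
  interpret D: parking_function n k D using assms by unfold_locales
  interpret E: parking_function n k E using assms by unfold_locales
  have "keys n k (xpos D) = keys n k (xpos E)"
    unfolding keys_def using assms(4) by (intro arg_cong2[of _ _ _ _ "(\<union>)"] image_cong) auto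
  then show ?thesis using D.path_eq E.path_eq by simp
qed

text \<open>The hypothesis is the usual criterion for a parking function. The path is obtained by sorting the
step codes. It stays above the diagonal: if only \<open>N < n\<close> north steps come before a point, then by
the criterion one of the north steps still to come has an abscissa of at most \<open>k * N\<close>.\<close>

lemma PF_of_columns:
  assumes enough: "\<And>i. i \<in> {1..n} \<Longrightarrow> i \<le> card {l \<in> {1..n}. x l \<le> k * (i - 1)}"
  shows "\<exists>E \<in> PF n k. \<forall>l \<in> {1..n}. xpos E l = x l"
proof -
  define K where "K = sorted_list_of_set (keys n k x)"
  define E where "E = map (step_of n) K"
  define nk where "nk l = x l * (n + 2) + l" for l
  define ek where "ek c = c * (n + 2) + (n + 1)" for c
  have keys: "keys n k x = nk ` {1..n} \<union> ek ` {..<k * n}"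
    unfolding keys_def nk_def ek_def ..
  have setK: "set K = keys n k x" and distK: "distinct K" and sortK: "sorted_wrt (<) K"
    unfolding K_def using finite_keys by auto
  have nk: "nk l div (n + 2) = x l" "nk l mod (n + 2) = l" "step_of n (nk l) = North l"
    if "l \<in> {1..n}" for l
    using that div_mod_key[of l n "x l"] by (auto simp: nk_def step_of_def)
  have ek: "ek c div (n + 2) = c" "ek c mod (n + 2) = n + 1" "step_of n (ek c) = East" for c
    using div_mod_key[of "n + 1" n c] by (auto simp: ek_def step_of_def)
  have x_le: "x l \<le> k * n" if "l \<in> {1..n}" for l
  proof -
    have "n \<in> {1..n}" using that by simp
    then have "card {1..n} \<le> card {l \<in> {1..n}. x l \<le> k * (n - 1)}" using enough[of n] by simp
    then have "{l \<in> {1..n}. x l \<le> k * (n - 1)} = {1..n}"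
      by (intro card_seteq) auto
    then have "x l \<le> k * (n - 1)" using that by blast
    also have "\<dots> \<le> k * n" by simp
    finally show ?thesis .
  qed
  have K_less: "K ! p < K ! q" if "p < q" "q < length K" for p q
    using sortK that by (simp add: sorted_wrt_iff_nth_less)
  have take_K: "set (take q K) = {z \<in> keys n k x. z < K ! q}" if q: "q < length K" for q
  proof -
    have "z < K ! q \<longleftrightarrow> z \<in> set (take q K)" if z: "z \<in> set K" for z
    proof -
      obtain p where p: "p < length K" "z = K ! p" using z by (auto simp: in_set_conv_nth)
      have "K ! p < K ! q \<longleftrightarrow> p < q"
        using K_less[of p q] K_less[of q p] p q by (cases p q rule: linorder_cases) auto
      moreover have "K ! p \<in> set (take q K) \<longleftrightarrow> p < q"
        using p q nth_eq_iff_index_eq[OF distK] by (auto simp: in_set_conv_nth)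
      ultimately show ?thesis using p by simp
    qed
    then show ?thesis using setK set_take_subset[of q K] by blast
  qed
  have card_steps: "easts (map (step_of n) L) = card {c. c < k * n \<and> ek c \<in> set L}"
      "norths (map (step_of n) L) = card {l \<in> {1..n}. nk l \<in> set L}"
    if L: "distinct L" "set L \<subseteq> keys n k x" for L
  proof -
    have "{z \<in> set L. step_of n z = East} = ek ` {c. c < k * n \<and> ek c \<in> set L}"
      using L(2) nk ek unfolding keys by auto
    moreover have "inj_on ek A" for A using ek(1) by (metis inj_onI)
    ultimately have "card {z \<in> set L. step_of n z = East} = card {c. c < k * n \<and> ek c \<in> set L}"
      by (simp add: card_image)
    moreover have "easts (map (step_of n) L) = card {z \<in> set L. step_of n z = East}"
      using distinct_length_filter[OF L(1), of "\<lambda>z. step_of n z = East"]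
      by (simp add: easts_def filter_map o_def Int_def conj_commute)
    ultimately show "easts (map (step_of n) L) = card {c. c < k * n \<and> ek c \<in> set L}" by simp
    have "{z \<in> set L. is_north (step_of n z)} = nk ` {l \<in> {1..n}. nk l \<in> set L}"
      using L(2) nk ek unfolding keys by auto
    moreover have "inj_on nk {l \<in> {1..n}. nk l \<in> set L}"
      by (rule inj_on_inverseI[of _ "\<lambda>z. z mod (n + 2)"]) (use nk in auto)
    ultimately have "card {z \<in> set L. is_north (step_of n z)} = card {l \<in> {1..n}. nk l \<in> set L}"
      by (simp add: card_image)
    moreover have "norths (map (step_of n) L) = card {z \<in> set L. is_north (step_of n z)}"
      using distinct_length_filter[OF L(1), of "\<lambda>z. is_north (step_of n z)"]
      by (simp add: norths_def filter_map o_def Int_def conj_commute)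
    ultimately show "norths (map (step_of n) L) = card {l \<in> {1..n}. nk l \<in> set L}" by simp
  qed
  have easts_take: "easts (take q E) = K ! q div (n + 2)" if q: "q < length K" for q
  proof -
    have z: "K ! q \<in> keys n k x" using q setK nth_mem by blast
    have le: "K ! q div (n + 2) \<le> k * n"
      using z x_le nk(1) ek(1) unfolding keys by fastforce
    have less: "ek c < K ! q \<longleftrightarrow> c < K ! q div (n + 2)" for c
    proof -
      have "ek c < K ! q \<longleftrightarrow> Suc c * (n + 2) \<le> K ! q" by (simp add: ek_def) linarith
      also have "\<dots> \<longleftrightarrow> Suc c \<le> K ! q div (n + 2)" by (simp add: less_eq_div_iff_mult_less_eq)
      finally show ?thesis by (simp add: Suc_le_eq)
    qed
    have "ek c \<in> keys n k x" if "c < k * n" for c using that unfolding keys by blast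
    then have "c < k * n \<and> ek c \<in> set (take q K) \<longleftrightarrow> c < K ! q div (n + 2)" for c
      unfolding take_K[OF q] using less[of c] le by fastforce
    then have "{c. c < k * n \<and> ek c \<in> set (take q K)} = {..<K ! q div (n + 2)}" by blast
    then have "card {c. c < k * n \<and> ek c \<in> set (take q K)} = K ! q div (n + 2)" by simp
    then show ?thesis
      using card_steps(1)[of "take q K"] distK setK set_take_subset[of q K]
      by (simp add: E_def take_map)
  qed
  have norths_take: "norths (take q E) = card {l \<in> {1..n}. nk l < K ! q}" if q: "q < length K" for q
  proof -
    have "{l \<in> {1..n}. nk l \<in> set (take q K)} = {l \<in> {1..n}. nk l < K ! q}"
      unfolding take_K[OF q] keys by blast
    then show ?thesis
      using card_steps(2)[of "take q K"] distK setK set_take_subset[of q K]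
      by (simp add: E_def take_map)
  qed
  have easts_E: "easts E = k * n"
  proof -
    have "{c. c < k * n \<and> ek c \<in> set K} = {..<k * n}" unfolding setK keys by auto
    then show ?thesis using card_steps(1)[of K] distK setK by (simp add: E_def)
  qed
  have norths_E: "norths E = n"
  proof -
    have "{l \<in> {1..n}. nk l \<in> set K} = {1..n}" unfolding setK keys by auto
    then show ?thesis using card_steps(2)[of K] distK setK by (simp add: E_def)
  qed
  have "E \<in> PF n k"
    unfolding PF_def
  proof (intro CollectI conjI allI impI)
    show "easts E = k * n" by (rule easts_E)
    show set_E: "set (labels E) = {1..n}"
    proof (intro set_eqI)
      fix l
      have "North l \<in> set E \<longleftrightarrow> l \<in> {1..n}"
      proof
        assume "North l \<in> set E"
        then obtain z where "z \<in> keys n k x" "step_of n z = North l"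
          unfolding E_def using setK by auto
        then show "l \<in> {1..n}" using nk(3) ek(3) unfolding keys by auto
      next
        assume "l \<in> {1..n}"
        then have "nk l \<in> set K" "step_of n (nk l) = North l" using nk setK keys by auto
        then show "North l \<in> set E" unfolding E_def by force
      qed
      then show "l \<in> set (labels E) \<longleftrightarrow> l \<in> {1..n}" by (simp add: in_labels_iff)
    qed
    show "distinct (labels E)"
      by (rule card_distinct) (simp add: set_E length_labels norths_E)
    show "easts (take p E) \<le> k * norths (take p E)" if "p \<le> length E" for p
    proof (cases "p < length E \<and> norths (take p E) < n")
      case True
      then have p: "p < length K" by (simp add: E_def)
      define N where "N = norths (take p E)"
      have "Suc N \<le> card {l \<in> {1..n}. x l \<le> k * N}"
        using enough[of "Suc N"] True by (simp add: N_def)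
      moreover have "card {l \<in> {1..n}. nk l < K ! p} = N" using norths_take[OF p] by (simp add: N_def)
      ultimately have lt: "card {l \<in> {1..n}. nk l < K ! p} < card {l \<in> {1..n}. x l \<le> k * N}"
        by linarith
      have "\<not> {l \<in> {1..n}. x l \<le> k * N} \<subseteq> {l \<in> {1..n}. nk l < K ! p}"
      proof
        assume "{l \<in> {1..n}. x l \<le> k * N} \<subseteq> {l \<in> {1..n}. nk l < K ! p}"
        then have "card {l \<in> {1..n}. x l \<le> k * N} \<le> card {l \<in> {1..n}. nk l < K ! p}"
          by (intro card_mono) simp_all
        then show False using lt by linarith
      qed
      then obtain l where l: "l \<in> {1..n}" "x l \<le> k * N" "\<not> nk l < K ! p" by blast
      have "easts (take p E) = K ! p div (n + 2)" by (rule easts_take[OF p])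
      also have "\<dots> \<le> nk l div (n + 2)" using l by (intro div_le_mono) simp
      also have "\<dots> \<le> k * N" using nk(1)[OF l(1)] l by simp
      finally show ?thesis by (simp add: N_def)
    next
      case False
      have "norths (take p E) = n"
        using False that norths_E norths_take_mono[of p "length E" E] by (cases "p = length E") auto
      then show ?thesis using easts_E easts_take_mono[OF that, of E] by simp
    qed
    show "l < m" if "p < q \<and> q < length E \<and> E ! p = North l \<and> E ! q = North m \<and>
        easts (take p E) = easts (take q E)" for p q l m
    proof -
      have pq: "p < q" "q < length K" "p < length K" using that by (auto simp: E_def)
      have l: "K ! p mod (n + 2) = l" and m: "K ! q mod (n + 2) = m"
        using that pq by (auto simp: E_def step_of_def split: if_splits)
      have "K ! p div (n + 2) = K ! q div (n + 2)"
        using easts_take[OF pq(2)] easts_take[OF pq(3)] that by simp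
      then have "K ! p = K ! q div (n + 2) * (n + 2) + l" "K ! q = K ! q div (n + 2) * (n + 2) + m"
        using l m div_mult_mod_eq[of "K ! p" "n + 2"] div_mult_mod_eq[of "K ! q" "n + 2"] by metis+
      then show ?thesis using K_less[OF pq(1,2)] by linarith
    qed
  qed
  moreover have "xpos E l = x l" if l: "l \<in> {1..n}" for l
  proof -
    have "nk l \<in> set K" using l setK keys by auto
    then obtain q where q: "q < length K" "K ! q = nk l" by (auto simp: in_set_conv_nth)
    have "takeWhile (\<lambda>s. s \<noteq> North l) E = take q E"
    proof (rule takeWhile_eq_take_P_nth)
      fix i assume i: "i < q" "i < length E"
      show "E ! i \<noteq> North l"
      proof
        assume "E ! i = North l"
        then have s: "step_of n (K ! i) = North l" using i by (simp add: E_def)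
        have "K ! i \<in> keys n k x" using i setK nth_mem by (metis E_def length_map)
        then have "K ! i = nk l" using s nk(3) ek(3) unfolding keys by auto
        then show False using q i K_less[of i q] by simp
      qed
    next
      show "\<not> E ! q \<noteq> North l" using q nk(3)[OF l] by (simp add: E_def)
    qed
    then show ?thesis using easts_take[OF q(1)] q nk(1)[OF l] by (simp add: xpos_def)
  qed
  ultimately show ?thesis by blast
qed
section \<open>Dinv of a path\<close>

lemma size_filter_mset_sum:
  assumes "finite A" "set_mset M \<subseteq> A"
  shows "size (filter_mset P M) = (\<Sum>z \<in> {z \<in> A. P z}. count M z)"
proof -
  have "size (filter_mset P M) = (\<Sum>z \<in> {z \<in> set_mset M. P z}. count M z)"
    unfolding size_multiset_overloaded_eq by (intro sum.cong) auto
  also have "\<dots> = (\<Sum>z \<in> {z \<in> A. P z}. count M z)"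
    using assms by (intro sum.mono_neutral_left) (auto simp: count_eq_zero_iff)
  finally show ?thesis .
qed

context parking_function
begin

lemma lab_area_eq: "l \<in> {1..n} \<Longrightarrow> lab_area k D l = int (ht l)"
  using ht_eq[of l] labels_ypos[of l]
  by (simp add: lab_area_def row_area_def row_label_def row_of_def ht_def of_nat_diff)

lemma east_steps_eq: "east_steps D = (\<lambda>c. (c, row c)) ` {..<k * n}"
proof -
  have norths: "norths (take p D) = row (easts (take p D))" if p: "p < length D" "D ! p = East" for p
  proof -
    have "xpos D l \<le> easts (take p D) \<longleftrightarrow> l \<in> set (labels (take p D))" if l: "l \<in> {1..n}" for l
    proof -
      have "pos l \<noteq> p" using pos(2)[OF l] p by auto
      have "xpos D l \<le> easts (take p D) \<longleftrightarrow> pos l < p"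
        using easts_take_mono[of "pos l" p D] easts_take_less[of p "pos l" D] pos[OF l] p \<open>pos l \<noteq> p\<close>
        by (cases "pos l < p") auto
      also have "\<dots> \<longleftrightarrow> North l \<in> set (take p D)"
      proof
        assume "pos l < p"
        then show "North l \<in> set (take p D)"
          using pos[OF l] by (auto simp: in_set_conv_nth intro: exI[of _ "pos l"])
      next
        assume "North l \<in> set (take p D)"
        then obtain i where "i < p" "D ! i = North l" by (auto simp: in_set_conv_nth)
        then show "pos l < p" using pos_unique(2)[of i l] p by simp
      qed
      finally show ?thesis by (simp add: in_labels_iff)
    qed
    moreover have "set (labels (take p D)) \<subseteq> {1..n}"
      using set_labels set_take_subset[of p D] in_labels_iff by blast
    ultimately have "{l \<in> {1..n}. xpos D l \<le> easts (take p D)} = set (labels (take p D))" by blast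
    moreover have "distinct (labels (take p D))"
      using distinct_labels by (metis append_take_drop_id distinct_append path_append_simps(3))
    ultimately show ?thesis by (simp add: row_def distinct_card length_labels)
  qed
  show ?thesis
  proof
    show "east_steps D \<subseteq> (\<lambda>c. (c, row c)) ` {..<k * n}"
    proof
      fix e assume "e \<in> east_steps D"
      then obtain p where p: "p < length D" "D ! p = East" "e = (easts (take p D), norths (take p D))"
        by (auto simp: east_steps_def)
      moreover have "easts (take p D) < k * n"
        using easts_take_less[OF p(1) order_refl p(2)] easts_D by simp
      ultimately show "e \<in> (\<lambda>c. (c, row c)) ` {..<k * n}" using norths by auto
    qed
    show "(\<lambda>c. (c, row c)) ` {..<k * n} \<subseteq> east_steps D"
    proof
      fix e assume "e \<in> (\<lambda>c. (c, row c)) ` {..<k * n}"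
      then obtain c where c: "c < k * n" "e = (c, row c)" by auto
      then obtain p where p: "p < length D" "D ! p = East" "easts (take p D) = c"
        using east_step_exists[of c D] easts_D by auto
      then have "e = (easts (take p D), norths (take p D))" using norths c by simp
      then show "e \<in> east_steps D" using p unfolding east_steps_def by blast
    qed
  qed
qed

text \<open>On the vertical line of \<open>l\<close>, the shadow of the east step is the open segment between the heights
\<open>level c - 1\<close> and \<open>level c\<close>. It meets the north step iff this unit interval lies between the
heights \<open>ht l\<close> and \<open>ht l + k\<close> of its endpoints.\<close>

lemma met_by_iff:
  assumes c: "c < k * n" and l: "l \<in> {1..n}"
  shows "l \<in> met_by k D (c, row c) \<longleftrightarrow> xpos D l \<le> c \<and> ht l < level c \<and> level c \<le> ht l + k"
proof -
  have k0: "real k > 0" using k_ge_1 by simp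
  have h: "real (ht l) + real (xpos D l) = real k * real (ypos D l)"
    using ht_eq[OF l] by (metis of_nat_add of_nat_mult)
  have v: "real (level c) + real c = real k * real (row c)"
    using level_eq(1)[OF c] by (metis of_nat_add of_nat_mult)
  have "l \<in> met_by k D (c, row c) \<longleftrightarrow>
    (\<exists>z. real (ypos D l) \<le> z \<and> z \<le> real (ypos D l) + 1 \<and> z \<le> real (row c) \<and>
      (1 / real k) * (real (xpos D l) - real c - 1) < z - real (row c) \<and>
      z - real (row c) < (1 / real k) * (real (xpos D l) - real c))"
    using l set_labels by (auto simp: met_by_def)
  also have "\<dots> \<longleftrightarrow>
    (\<exists>z. real (ypos D l) \<le> z \<and> z \<le> real (ypos D l) + 1 \<and> z \<le> real (row c) \<and>
      real (xpos D l) - real c - 1 < real k * (z - real (row c)) \<and>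
      real k * (z - real (row c)) < real (xpos D l) - real c)"
    using k0 by (simp add: field_simps)
  also have "\<dots> \<longleftrightarrow> xpos D l \<le> c \<and> ht l < level c \<and> level c \<le> ht l + k"
  proof
    assume "\<exists>z. real (ypos D l) \<le> z \<and> z \<le> real (ypos D l) + 1 \<and> z \<le> real (row c) \<and>
      real (xpos D l) - real c - 1 < real k * (z - real (row c)) \<and>
      real k * (z - real (row c)) < real (xpos D l) - real c"
    then obtain z where z: "real (ypos D l) \<le> z" "z \<le> real (ypos D l) + 1" "z \<le> real (row c)"
      "real (xpos D l) - real c - 1 < real k * (z - real (row c))"
      "real k * (z - real (row c)) < real (xpos D l) - real c" by blast
    have "real k * (z - real (row c)) \<le> 0" using z(3) k0 by (simp add: mult_nonneg_nonpos)
    then have "xpos D l \<le> c" using z(4) by linarith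
    moreover have "real k * real (ypos D l) \<le> real k * z" "real k * z \<le> real k * (real (ypos D l) + 1)"
      using z(1,2) k0 by simp_all
    then have "real (ht l) < real (level c)" "real (level c) < real (ht l) + real k + 1"
      using z(4,5) h v by (simp_all add: algebra_simps)
    ultimately show "xpos D l \<le> c \<and> ht l < level c \<and> level c \<le> ht l + k" by linarith
  next
    assume a: "xpos D l \<le> c \<and> ht l < level c \<and> level c \<le> ht l + k"
    \<comment> \<open>the point of height \<open>level c - 1 / 2\<close>, inside the shadow\<close>
    define z where "z = (real (level c) - 1 / 2 + real (xpos D l)) / real k"
    have kz: "real k * z = real (level c) - 1 / 2 + real (xpos D l)" using k0 by (simp add: z_def)
    have "real (ht l) + 1 \<le> real (level c)" "real (level c) \<le> real (ht l) + real k" using a by linarith+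
    then have "real k * real (ypos D l) \<le> real k * z" "real k * z \<le> real k * (real (ypos D l) + 1)"
      using kz h by (simp_all add: distrib_left)
    moreover have "real k * z \<le> real k * real (row c)" using kz v a by linarith
    ultimately have "real (ypos D l) \<le> z" "z \<le> real (ypos D l) + 1" "z \<le> real (row c)"
      using k0 by simp_all
    moreover have "real (xpos D l) - real c - 1 < real k * (z - real (row c))"
      "real k * (z - real (row c)) < real (xpos D l) - real c"
      using kz v by (simp_all add: right_diff_distrib)
    ultimately show "\<exists>z. real (ypos D l) \<le> z \<and> z \<le> real (ypos D l) + 1 \<and> z \<le> real (row c) \<and>
      real (xpos D l) - real c - 1 < real k * (z - real (row c)) \<and>
      real k * (z - real (row c)) < real (xpos D l) - real c" by blast
  qed
  finally show ?thesis .
qed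

text \<open>The steps met start below \<open>level c\<close>, so none of them comes after the owner. The label is unique
since two steps on one vertical line differ in height by at least \<open>k\<close>.\<close>

lemma east_label_owner:
  assumes c: "c < k * n" and l: "owner l c"
  shows "east_label k D (c, row c) = l"
proof -
  have l': "l \<in> {1..n}" "xpos D l \<le> c" "ht l < level c" using l by (auto simp: owner_def)
  have met: "l \<in> met_by k D (c, row c)" using met_by_iff[OF c l'(1)] l' owner_level_le[OF c l] by simp
  have label: "m \<in> {1..n}" if "m \<in> met_by k D (c, row c)" for m
    using that set_labels by (simp add: met_by_def)
  have max: "xpos D m \<le> xpos D l" if m: "m \<in> met_by k D (c, row c)" for m
  proof -
    have m': "m \<in> {1..n}" "xpos D m \<le> c" "ht m < level c"
      using met_by_iff[OF c label[OF m]] label[OF m] m by simp_all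
    then have "\<not> ypos D l < ypos D m" using l unfolding owner_def by force
    then show ?thesis using x_mono'[OF m'(1) l'(1)] by simp
  qed
  show ?thesis
    unfolding east_label_def
  proof (rule the_equality)
    show "l \<in> met_by k D (c, row c) \<and> (\<forall>m \<in> met_by k D (c, row c). xpos D m \<le> xpos D l)"
      using met max by blast
    fix m assume m: "m \<in> met_by k D (c, row c) \<and> (\<forall>v \<in> met_by k D (c, row c). xpos D v \<le> xpos D m)"
    then have m': "m \<in> {1..n}" "ht m < level c" "level c \<le> ht m + k"
      using met_by_iff[OF c label] label by blast+
    have x: "xpos D m = xpos D l" using m met max by (intro antisym) auto
    have far: "ht v + k \<le> ht w" if "v \<in> {1..n}" "w \<in> {1..n}" "xpos D v = xpos D w" "ypos D v < ypos D w" for v w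
    proof -
      have "k * Suc (ypos D v) \<le> k * ypos D w" using that(4) by (intro mult_le_mono2) simp
      then show ?thesis using ht_eq[OF that(1)] ht_eq[OF that(2)] that(3) by simp
    qed
    have "\<not> ypos D m < ypos D l" using far[OF m'(1) l'(1) x] m' l' by linarith
    moreover have "\<not> ypos D l < ypos D m"
      using far[OF l'(1) m'(1) x[symmetric]] m' owner_level_le[OF c l] by linarith
    ultimately show "m = l" using y_inj[OF m'(1) l'(1)] by simp
  qed
qed

text \<open>Shadows are convex, so it suffices to test the two endpoints of the east step.\<close>

lemma east_seg_subset_iff:
  assumes c: "c < k * n" and m: "m \<in> {1..n}"
  shows "east_seg (c, row c) \<subseteq> north_shadow k (xpos D m, ypos D m) \<longleftrightarrow>
    c < xpos D m \<and> ht m + 2 \<le> level c \<and> level c \<le> ht m + k"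
proof -
  have k0: "real k > 0" using k_ge_1 by simp
  have h: "real (ht m) + real (xpos D m) = real k * real (ypos D m)"
    using ht_eq[OF m] by (metis of_nat_add of_nat_mult)
  have v: "real (level c) + real c = real k * real (row c)"
    using level_eq(1)[OF c] by (metis of_nat_add of_nat_mult)
  have point: "(z, real (row c)) \<in> north_shadow k (xpos D m, ypos D m) \<longleftrightarrow>
      z \<le> real (xpos D m) \<and> real (ht m) + z < real (level c) + real c \<and>
      real (level c) + real c \<le> z + real (ht m) + real k" for z
  proof -
    have "(z, real (row c)) \<in> north_shadow k (xpos D m, ypos D m) \<longleftrightarrow>
      z \<le> real (xpos D m) \<and> z - real (xpos D m) < real k * real (row c) - real k * real (ypos D m) \<and>
      real k * real (row c) - real k * real (ypos D m) \<le> z - real (xpos D m) + real k"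
      using k0 by (simp add: field_simps)
    then show ?thesis using h v by linarith
  qed
  have "east_seg (c, row c) \<subseteq> north_shadow k (xpos D m, ypos D m) \<longleftrightarrow>
      (\<forall>z. real c \<le> z \<and> z \<le> real c + 1 \<longrightarrow> (z, real (row c)) \<in> north_shadow k (xpos D m, ypos D m))"
    by auto
  also have "\<dots> \<longleftrightarrow> (real c, real (row c)) \<in> north_shadow k (xpos D m, ypos D m) \<and>
      (real c + 1, real (row c)) \<in> north_shadow k (xpos D m, ypos D m)"
    (is "(\<forall>z. ?I z \<longrightarrow> ?in z) \<longleftrightarrow> ?in1 \<and> ?in2")
  proof
    assume *: "\<forall>z. ?I z \<longrightarrow> ?in z"
    show "?in1 \<and> ?in2" using *[rule_format, of "real c"] *[rule_format, of "real c + 1"] by simp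
  next
    assume "?in1 \<and> ?in2"
    then show "\<forall>z. ?I z \<longrightarrow> ?in z" unfolding point by (intro allI impI) linarith
  qed
  also have "\<dots> \<longleftrightarrow> c < xpos D m \<and> ht m + 2 \<le> level c \<and> level c \<le> ht m + k"
    unfolding point by linarith
  finally show ?thesis .
qed

lemma finite_east_steps: "finite (east_steps D)"
  by (simp add: east_steps_eq)

lemma Dinvcorr_props:
  shows "set_mset (Dinvcorr k D) \<subseteq> {1..n} \<times> {1..n}"
    and "p \<in> {1..n} \<Longrightarrow> q \<in> {1..n} \<Longrightarrow>
      count (Dinvcorr k D) (p, q) = (if ypos D p < ypos D q then corr p q else 0)"
proof -
  define W where "W = {(e, m). e \<in> east_steps D \<and> m \<in> set (labels D) \<and>
        east_seg e \<subseteq> north_shadow k (xpos D m, ypos D m)}"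
  have W: "W \<subseteq> east_steps D \<times> {1..n}" using set_labels by (auto simp: W_def)
  then have finW: "finite W" by (rule finite_subset) (simp add: finite_east_steps)
  have Dc: "Dinvcorr k D = image_mset (\<lambda>(e, m). (east_label k D e, m)) (mset_set W)"
    by (simp add: Dinvcorr_def W_def)
  have label: "east_label k D (c, row c) = l \<longleftrightarrow> owner l c" if "c < k * n" for c l
    using owner_exists[OF that] east_label_owner[OF that] by blast
  have label_in: "east_label k D e \<in> {1..n}" if e: "e \<in> east_steps D" for e
  proof -
    obtain c where c: "c < k * n" "e = (c, row c)" using e east_steps_eq by auto
    then have "owner (east_label k D e) c" using label by blast
    then show ?thesis by (simp add: owner_def)
  qed
  show "set_mset (Dinvcorr k D) \<subseteq> {1..n} \<times> {1..n}"
    unfolding Dc using W label_in finW by auto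
  assume pq: "p \<in> {1..n}" "q \<in> {1..n}"
  let ?C = "{c. c < k * n \<and> owner p c \<and> c < xpos D q \<and> ht q + 2 \<le> level c \<and> level c \<le> ht q + k}"
  have "count (Dinvcorr k D) (p, q) = card {w \<in> W. (case w of (e, m) \<Rightarrow> (east_label k D e, m)) = (p, q)}"
    unfolding Dc count_image_mset' using finW
    by (simp add: Collect_conj_eq Int_commute) (metis (lifting) eq_commute)
  also have "{w \<in> W. (case w of (e, m) \<Rightarrow> (east_label k D e, m)) = (p, q)} = (\<lambda>c. ((c, row c), q)) ` ?C"
  proof
    show "{w \<in> W. (case w of (e, m) \<Rightarrow> (east_label k D e, m)) = (p, q)} \<subseteq> (\<lambda>c. ((c, row c), q)) ` ?C"
    proof
      fix w assume w: "w \<in> {w \<in> W. (case w of (e, m) \<Rightarrow> (east_label k D e, m)) = (p, q)}"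
      then obtain e where e: "w = (e, q)" "e \<in> east_steps D" "east_label k D e = p"
        "east_seg e \<subseteq> north_shadow k (xpos D q, ypos D q)" by (auto simp: W_def)
      then obtain c where c: "c < k * n" "e = (c, row c)" using east_steps_eq by auto
      then have "c \<in> ?C" using e label[OF c(1)] east_seg_subset_iff[OF c(1) pq(2)] by simp
      then show "w \<in> (\<lambda>c. ((c, row c), q)) ` ?C" using e c by blast
    qed
    show "(\<lambda>c. ((c, row c), q)) ` ?C \<subseteq> {w \<in> W. (case w of (e, m) \<Rightarrow> (east_label k D e, m)) = (p, q)}"
    proof
      fix w assume "w \<in> (\<lambda>c. ((c, row c), q)) ` ?C"
      then obtain c where c: "c \<in> ?C" "w = ((c, row c), q)" by blast
      then have "(c, row c) \<in> east_steps D" "east_label k D (c, row c) = p"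
        "east_seg (c, row c) \<subseteq> north_shadow k (xpos D q, ypos D q)"
        using east_steps_eq label east_seg_subset_iff[OF _ pq(2)] by auto
      then show "w \<in> {w \<in> W. (case w of (e, m) \<Rightarrow> (east_label k D e, m)) = (p, q)}"
        unfolding W_def c(2) set_labels using pq by simp
    qed
  qed
  also have "card ((\<lambda>c. ((c, row c), q)) ` ?C) = card ?C"
    by (intro card_image inj_onI) simp
  also have "\<dots> = (if ypos D p < ypos D q then corr p q else 0)"
    by (rule card_owned_steps[OF pq])
  finally show "count (Dinvcorr k D) (p, q) = (if ypos D p < ypos D q then corr p q else 0)" .
qed

text \<open>The conditions on heights exclude two steps on the same vertical line, so a smaller column may be
replaced by an earlier position on the path.\<close>

lemma Tdinv_iff:
  assumes p: "p \<in> {1..n}" and q: "q \<in> {1..n}"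
  shows "(p, q) \<in> Tdinv n k D \<longleftrightarrow> ypos D p < ypos D q \<and> tdinv p q"
proof -
  have "(p, q) \<in> Tdinv n k D \<longleftrightarrow> xpos D p < xpos D q \<and> tdinv p q"
    using p q by (auto simp: Tdinv_def col_def lab_area_eq tdinv_def)
  also have "\<dots> \<longleftrightarrow> ypos D p < ypos D q \<and> tdinv p q"
  proof -
    have "ypos D p < ypos D q" if "xpos D p < xpos D q"
      using x_mono'[OF q p] that by linarith
    moreover have "xpos D p < xpos D q" if less: "ypos D p < ypos D q" and t: "tdinv p q"
    proof (rule ccontr)
      assume "\<not> ?thesis"
      then have x: "xpos D p = xpos D q" using x_mono[OF p q less] by simp
      then have "p < q" using x_eq[OF p q less] by simp
      moreover have "k * Suc (ypos D p) \<le> k * ypos D q" using less by (intro mult_le_mono2) simp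
      then have "ht p + k \<le> ht q" using ht_eq[OF p] ht_eq[OF q] x by simp
      ultimately show False using t by (auto simp: tdinv_def)
    qed
    ultimately show ?thesis by blast
  qed
  finally show ?thesis .
qed

lemma finite_Tdinv: "finite (Tdinv n k D)"
  by (rule finite_subset[of _ "{1..n} \<times> {1..n}"]) (auto simp: Tdinv_def)

lemma set_Dinv: "set_mset (Dinv n k D) \<subseteq> {1..n} \<times> {1..n}"
  using Dinvcorr_props(1) finite_Tdinv by (auto simp: Dinv_def Tdinv_def)

lemma count_Dinv:
  assumes "p \<in> {1..n}" "q \<in> {1..n}"
  shows "count (Dinv n k D) (p, q) = dinv_mult p q"
  using Dinvcorr_props(2)[OF assms] Tdinv_iff[OF assms] finite_Tdinv
  by (simp add: Dinv_def dinv_mult_def count_mset_set')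

end

section \<open>The diagonal reading word\<close>

lemma sorted_wrt_insort_key:
  fixes f :: "'a \<Rightarrow> 'b :: linorder"
  defines "S \<equiv> \<lambda>R u v. f u < f v \<or> f u = f v \<and> R u v"
  assumes "sorted_wrt (S R) xs" "\<And>v. v \<in> set xs \<Longrightarrow> R a v"
  shows "sorted_wrt (S R) (insort_key f a xs)"
  using assms(2,3)
proof (induction xs)
  case (Cons b xs)
  show ?case
  proof (cases "f a \<le> f b")
    case True
    have "S R a v" if "v \<in> set (b # xs)" for v
      using that Cons.prems True unfolding S_def by fastforce
    then show ?thesis using True Cons.prems(1) by simp
  next
    case False
    have "S R b v" if "v \<in> set (insort_key f a xs)" for v
      using that Cons.prems(1) False by (auto simp: set_insort_key S_def)
    then show ?thesis using False Cons by simp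
  qed
qed simp

text \<open>Stability of \<^const>\<open>sort_key\<close>: ties keep their old order.\<close>

lemma sorted_wrt_sort_key:
  fixes f :: "'a \<Rightarrow> 'b :: linorder"
  assumes "sorted_wrt R xs"
  shows "sorted_wrt (\<lambda>u v. f u < f v \<or> f u = f v \<and> R u v) (sort_key f xs)"
  using assms
proof (induction xs)
  case (Cons a xs)
  then show ?case using sorted_wrt_insort_key[of f R "sort_key f xs" a] by simp
qed simp

context parking_function
begin

lemma set_wdiag: "set (wdiag k D) = {1..n}"
  by (simp add: wdiag_def set_labels)

lemma distinct_wdiag: "distinct (wdiag k D)"
  by (simp add: wdiag_def distinct_labels)

lemma length_wdiag: "length (wdiag k D) = n"
  by (simp add: wdiag_def length_labels norths_D)

lemma sorted_wdiag: "sorted_wrt before (wdiag k D)"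
proof -
  have "ypos D (labels D ! i) = i" if "i < n" for i
  proof -
    have i: "i < length (labels D)" using that by (simp add: length_labels norths_D)
    then have l: "labels D ! i \<in> {1..n}" using set_labels nth_mem by blast
    then have "labels D ! ypos D (labels D ! i) = labels D ! i" by (rule labels_ypos)
    moreover have "ypos D (labels D ! i) < length (labels D)"
      using ypos_less[OF l] by (simp add: length_labels norths_D)
    ultimately show ?thesis using nth_eq_iff_index_eq[OF distinct_labels] i by blast
  qed
  then have "sorted_wrt (\<lambda>u v. ypos D u < ypos D v) (labels D)"
    by (simp add: sorted_wrt_iff_nth_less length_labels norths_D)
  then have "sorted_wrt (\<lambda>u v. lab_area k D u < lab_area k D v \<or>
      lab_area k D u = lab_area k D v \<and> ypos D u < ypos D v) (wdiag k D)"
    unfolding wdiag_def by (rule sorted_wrt_sort_key)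
  then show ?thesis
    by (rule sorted_wrt_mono_rel[rotated]) (use set_wdiag lab_area_eq in \<open>auto simp: before_def\<close>)
qed

lemma before_sig_iff:
  assumes "i \<in> {1..n}" "j \<in> {1..n}"
  shows "before (sig k D i) (sig k D j) \<longleftrightarrow> i < j"
proof -
  have less: "before (sig k D i) (sig k D j)" if "i < j" "i \<in> {1..n}" "j \<in> {1..n}" for i j
    using sorted_wdiag that length_wdiag unfolding sig_def sorted_wrt_iff_nth_less by auto
  show ?thesis
  proof (cases i j rule: linorder_cases)
    case greater
    then have "before (sig k D j) (sig k D i)" using less assms by blast
    then show ?thesis using greater by (auto simp: before_def)
  qed (use less assms in \<open>auto simp: before_def\<close>)
qed

lemma sig_bij: "bij_betw (sig k D) {1..n} {1..n}"
proof -
  have "bij_betw (\<lambda>i. i - 1) {1..n} {..<n}"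
    by (rule bij_betw_byWitness[where f' = Suc]) auto
  moreover have "bij_betw ((!) (wdiag k D)) {..<n} {1..n}"
    by (rule bij_betw_nth) (auto simp: distinct_wdiag length_wdiag set_wdiag)
  ultimately have "bij_betw ((!) (wdiag k D) \<circ> (\<lambda>i. i - 1)) {1..n} {1..n}"
    by (rule bij_betw_trans)
  then show ?thesis by (simp add: o_def sig_def[abs_def])
qed

lemma sig_in: "i \<in> {1..n} \<Longrightarrow> sig k D i \<in> {1..n}"
  using sig_bij by (rule bij_betw_apply)

lemma sig_surj: assumes "l \<in> {1..n}" obtains i where "i \<in> {1..n}" "sig k D i = l"
proof -
  have "l \<in> sig k D ` {1..n}" using sig_bij assms by (simp add: bij_betw_def)
  then show ?thesis using that by blast
qed

lemma card_before_sig: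
  assumes i: "i \<in> {1..n}"
  shows "card {u \<in> {1..n}. before u (sig k D i)} = i - 1"
proof -
  have "{u \<in> {1..n}. before u (sig k D i)} = sig k D ` {1..<i}"
  proof
    show "{u \<in> {1..n}. before u (sig k D i)} \<subseteq> sig k D ` {1..<i}"
    proof
      fix u assume u: "u \<in> {u \<in> {1..n}. before u (sig k D i)}"
      then obtain j where j: "j \<in> {1..n}" "sig k D j = u" using sig_surj by blast
      then have "j < i" using u before_sig_iff[OF j(1) i] by simp
      then show "u \<in> sig k D ` {1..<i}" using j by auto
    qed
    show "sig k D ` {1..<i} \<subseteq> {u \<in> {1..n}. before u (sig k D i)}"
    proof
      fix u assume "u \<in> sig k D ` {1..<i}"
      then obtain j where j: "j \<in> {1..<i}" "u = sig k D j" by blast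
      then have "j \<in> {1..n}" using i by auto
      then show "u \<in> {u \<in> {1..n}. before u (sig k D i)}"
        using sig_in before_sig_iff[of j i] i j by simp
    qed
  qed
  moreover have "inj_on (sig k D) {1..<i}"
    by (rule inj_on_subset[OF bij_betw_imp_inj_on[OF sig_bij]]) (use i in auto)
  ultimately show ?thesis by (simp add: card_image)
qed

text \<open>The member of a pair that comes second in the diagonal reading word.\<close>

definition later :: "nat \<times> nat \<Rightarrow> nat" where
  "later z = (if before (fst z) (snd z) then snd z else fst z)"

lemma lab_dinv_filter:
  "lab_dinv n k D l = size (filter_mset (\<lambda>z. later z = l) (Dinv n k D))"
proof -
  have "(\<exists>i \<in> {1..n}. \<exists>j \<in> {1..n}. p = sig k D i \<and> q = sig k D j \<and> sig k D (max i j) = l)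
      \<longleftrightarrow> later (p, q) = l" if pq: "(p, q) \<in># Dinv n k D" for p q
  proof -
    have "p \<in> {1..n}" "q \<in> {1..n}" using pq set_Dinv by auto
    then obtain i j where i: "i \<in> {1..n}" "sig k D i = p" and j: "j \<in> {1..n}" "sig k D j = q"
      using sig_surj by metis
    have inj: "i' = i" if "i' \<in> {1..n}" "sig k D i' = sig k D i" "i \<in> {1..n}" for i' i
      using bij_betw_imp_inj_on[OF sig_bij] that by (auto dest: inj_onD)
    have "later (p, q) = sig k D (max i j)"
      using before_sig_iff[OF i(1) j(1)] i j by (auto simp: later_def max_def dest: antisym)
    then show ?thesis using i j inj by metis
  qed
  then show ?thesis
    unfolding lab_dinv_def by (intro arg_cong[of _ _ size] filter_mset_cong) auto
qed

lemma lab_dinv_eq_sum: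
  assumes l: "l \<in> {1..n}"
  shows "lab_dinv n k D l = (\<Sum>u \<in> {u \<in> {1..n}. before u l}. dinv_mult u l + dinv_mult l u)"
proof -
  let ?B = "{u \<in> {1..n}. before u l}"
  let ?S = "{z \<in> {1..n} \<times> {1..n}. later z = l}"
  have total: "before q l \<longleftrightarrow> q \<noteq> l \<and> \<not> before l q" if "q \<in> {1..n}" for q
    using y_inj[OF that l] by (auto simp: before_def)
  have S: "?S = (\<lambda>u. (u, l)) ` ?B \<union> (\<lambda>u. (l, u)) ` (insert l ?B)"
  proof (intro set_eqI)
    fix z :: "nat \<times> nat"
    obtain p q where z: "z = (p, q)" by (cases z)
    show "z \<in> ?S \<longleftrightarrow> z \<in> (\<lambda>u. (u, l)) ` ?B \<union> (\<lambda>u. (l, u)) ` (insert l ?B)"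
      unfolding z using l total[of p] total[of q] by (auto simp: later_def)
  qed
  have nl: "\<not> before l l" by (simp add: before_def)
  have "lab_dinv n k D l = (\<Sum>z \<in> ?S. count (Dinv n k D) z)"
    unfolding lab_dinv_filter by (rule size_filter_mset_sum) (use set_Dinv in auto)
  also have "\<dots> = (\<Sum>z \<in> ?S. dinv_mult (fst z) (snd z))"
    by (intro sum.cong refl) (auto simp: count_Dinv)
  also have "\<dots> = (\<Sum>z \<in> (\<lambda>u. (u, l)) ` ?B. dinv_mult (fst z) (snd z)) +
      (\<Sum>z \<in> (\<lambda>u. (l, u)) ` (insert l ?B). dinv_mult (fst z) (snd z))"
    unfolding S by (intro sum.union_disjoint) (use nl in auto)
  also have "(\<Sum>z \<in> (\<lambda>u. (u, l)) ` ?B. dinv_mult (fst z) (snd z)) = (\<Sum>u \<in> ?B. dinv_mult u l)"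
    by (subst sum.reindex) (auto simp: inj_on_def)
  also have "(\<Sum>z \<in> (\<lambda>u. (l, u)) ` (insert l ?B). dinv_mult (fst z) (snd z)) = (\<Sum>u \<in> insert l ?B. dinv_mult l u)"
    by (subst sum.reindex) (auto simp: inj_on_def)
  also have "\<dots> = (\<Sum>u \<in> ?B. dinv_mult l u)"
    using nl by (simp add: dinv_mult_def)
  finally show ?thesis by (simp add: sum.distrib)
qed

lemma dinv_eq_sum: "dinv n k D = (\<Sum>l = 1..n. lab_dinv n k D l)"
proof -
  have "(\<Sum>l = 1..n. lab_dinv n k D l) =
      (\<Sum>l = 1..n. \<Sum>z \<in> {z \<in> {1..n} \<times> {1..n}. later z = l}. count (Dinv n k D) z)"
    unfolding lab_dinv_filter by (intro sum.cong refl size_filter_mset_sum) (use set_Dinv in auto)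
  also have "\<dots> = (\<Sum>z \<in> {1..n} \<times> {1..n}. count (Dinv n k D) z)"
    by (rule sum.group) (auto simp: later_def)
  also have "\<dots> = dinv n k D"
    using size_filter_mset_sum[of "{1..n} \<times> {1..n}" "Dinv n k D" "\<lambda>_. True"] set_Dinv
    by (simp add: dinv_def)
  finally show ?thesis by simp
qed

text \<open>The number of labels before \<open>sig k D i\<close> is \<open>i - 1\<close>, so \<open>sum_dinv_mult\<close> becomes the defining
equation of \<open>phi\<close>.\<close>

lemma lab_dinv_image_xpos:
  assumes i: "i \<in> {1..n}"
  shows "lab_dinv n k D (sig k D i) + image_xpos (sig k D i) = k * (i - 1)"
  using sum_dinv_mult[OF sig_in[OF i]] card_blocked_le[of "sig k D i"]
  unfolding lab_dinv_eq_sum[OF sig_in[OF i]] card_before_sig[OF i] image_xpos_def by linarith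

end
section \<open>The map phi\<close>

context parking_function
begin

lemma is_phi_image_iff:
  "is_phi_image n k D E \<longleftrightarrow> E \<in> PF n k \<and> (\<forall>l \<in> {1..n}. xpos E l = image_xpos l)"
proof -
  have "int (col E (sig k D i)) = int k * (int i - 1) - int (lab_dinv n k D (sig k D i)) + 1
      \<longleftrightarrow> xpos E (sig k D i) = image_xpos (sig k D i)" if i: "i \<in> {1..n}" for i
  proof -
    have "int (lab_dinv n k D (sig k D i)) + int (image_xpos (sig k D i)) = int k * (int i - 1)"
      using lab_dinv_image_xpos[OF i] i by (simp flip: of_nat_add add: of_nat_diff)
    then show ?thesis unfolding col_def by linarith
  qed
  then have "is_phi_image n k D E \<longleftrightarrow>
      E \<in> PF n k \<and> (\<forall>i \<in> {1..n}. xpos E (sig k D i) = image_xpos (sig k D i))"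
    unfolding is_phi_image_def by simp
  also have "\<dots> \<longleftrightarrow> E \<in> PF n k \<and> (\<forall>l \<in> {1..n}. xpos E l = image_xpos l)"
    using sig_in sig_surj by metis
  finally show ?thesis .
qed

text \<open>The \<open>i\<close>-th label of the reading word gets an abscissa of at most \<open>k * (i - 1)\<close>, so the first
\<open>i\<close> labels witness the criterion of \<open>PF_of_columns\<close>.\<close>

lemma phi_image_unique: "\<exists>!E. is_phi_image n k D E"
proof -
  have "i \<le> card {l \<in> {1..n}. image_xpos l \<le> k * (i - 1)}" if i: "i \<in> {1..n}" for i
  proof -
    have "image_xpos (sig k D j) \<le> k * (i - 1)" if j: "j \<in> {1..i}" for j
    proof -
      have "j \<in> {1..n}" using i j by auto
      then have "image_xpos (sig k D j) \<le> k * (j - 1)" using lab_dinv_image_xpos[of j] by simp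
      also have "\<dots> \<le> k * (i - 1)" using j by (intro mult_le_mono2) auto
      finally show ?thesis .
    qed
    then have "sig k D ` {1..i} \<subseteq> {l \<in> {1..n}. image_xpos l \<le> k * (i - 1)}"
      using sig_in i by fastforce
    then have "card (sig k D ` {1..i}) \<le> card {l \<in> {1..n}. image_xpos l \<le> k * (i - 1)}"
      by (intro card_mono) simp_all
    moreover have "inj_on (sig k D) {1..i}"
      by (rule inj_on_subset[OF bij_betw_imp_inj_on[OF sig_bij]]) (use i in auto)
    ultimately show ?thesis by (simp add: card_image)
  qed
  then obtain E where E: "E \<in> PF n k" "\<forall>l \<in> {1..n}. xpos E l = image_xpos l"
    using PF_of_columns[of n image_xpos k] by blast
  show ?thesis
    unfolding is_phi_image_iff
  proof (rule ex1I[of _ E])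
    fix F assume F: "F \<in> PF n k \<and> (\<forall>l \<in> {1..n}. xpos F l = image_xpos l)"
    show "F = E" by (rule PF_eqI[OF k_ge_1 _ E(1)]) (use E(2) F in simp_all)
  qed (use E in blast)
qed

lemma phi_props: "phi n k D \<in> PF n k" "l \<in> {1..n} \<Longrightarrow> xpos (phi n k D) l = image_xpos l"
  using theI'[OF phi_image_unique] unfolding phi_def is_phi_image_iff by blast+

lemma lab_pmaj_phi:
  assumes l: "l \<in> {1..n}"
  shows "lab_pmaj n k (phi n k D) l = ht l"
proof -
  interpret passes n k ht "phi n k D"
  proof
    show "nbrs n k ht l \<noteq> {}" if "l \<in> {1..n}" "ht l > 0" for l
      using nbr_left[OF that] by blast
    show "col (phi n k D) l \<le> Suc (\<Sum>u = 1..n. copies k ht (ht l) (Suc l) u)" if "l \<in> {1..n}" for l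
      using phi_props(2)[OF that] by (simp add: col_def image_xpos_def)
    show "Suc (\<Sum>u = 1..n. copies k ht r (Suc l) u) < col (phi n k D) l"
      if "l \<in> {1..n}" "ht l = Suc r" for l r
      using phi_props(2)[OF that(1)] image_xpos_gt[OF that] by (simp add: col_def)
  qed (rule k_ge_1)
  show ?thesis by (rule lab_pmaj_eq[OF l])
qed

lemma area_eq: "area n k D = (\<Sum>l = 1..n. int (ht l))"
proof -
  have "bij_betw Suc {..<n} {1..n}"
    by (rule bij_betw_byWitness[where f' = "\<lambda>i. i - 1"]) auto
  then have "bij_betw (Suc \<circ> ypos D) {1..n} {1..n}" by (rule bij_betw_trans[OF y_bij])
  then have "area n k D = (\<Sum>l = 1..n. row_area k D ((Suc \<circ> ypos D) l))"
    unfolding area_def by (rule sum.reindex_bij_betw[symmetric])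
  also have "\<dots> = (\<Sum>l = 1..n. int (ht l))"
    by (intro sum.cong refl) (simp add: lab_area_eq[unfolded lab_area_def row_of_def, symmetric])
  finally show ?thesis .
qed

lemma sum_ht_xpos: "(\<Sum>l = 1..n. ht l) + (\<Sum>l = 1..n. xpos D l) = (\<Sum>i<n. k * i)"
proof -
  have "(\<Sum>l = 1..n. ht l) + (\<Sum>l = 1..n. xpos D l) = (\<Sum>l = 1..n. k * ypos D l)"
    unfolding sum.distrib[symmetric] by (intro sum.cong refl ht_eq)
  also have "\<dots> = (\<Sum>i<n. k * i)" by (rule sum.reindex_bij_betw[OF y_bij])
  finally show ?thesis .
qed

text \<open>Heights and abscissae add up to the same total for every parking function, and so do the
contributions to dinv of \<open>D\<close> and the abscissae of its image.\<close>

lemma area_phi: "area n k (phi n k D) = int (dinv n k D)"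
proof -
  interpret E: parking_function n k "phi n k D" by unfold_locales (rule k_ge_1, rule phi_props(1))
  have "(\<Sum>l = 1..n. lab_dinv n k D l) + (\<Sum>l = 1..n. image_xpos l) =
      (\<Sum>i = 1..n. lab_dinv n k D (sig k D i)) + (\<Sum>i = 1..n. image_xpos (sig k D i))"
    by (simp only: sum.reindex_bij_betw[OF sig_bij])
  also have "\<dots> = (\<Sum>i = 1..n. k * (i - 1))"
    unfolding sum.distrib[symmetric] by (intro sum.cong refl lab_dinv_image_xpos)
  also have "\<dots> = (\<Sum>i<n. k * i)"
    by (rule sum.reindex_bij_witness[of _ Suc "\<lambda>i. i - 1"]) auto
  also have "\<dots> = (\<Sum>l = 1..n. E.ht l) + (\<Sum>l = 1..n. image_xpos l)"
    unfolding E.sum_ht_xpos[symmetric] by (simp add: phi_props(2))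
  finally have "dinv n k D = (\<Sum>l = 1..n. E.ht l)" by (simp add: dinv_eq_sum)
  then show ?thesis by (simp add: E.area_eq)
qed

lemma pmaj_phi: "int (pmaj n k (phi n k D)) = area n k D"
  unfolding pmaj_def area_eq by (simp add: lab_pmaj_phi)

end

lemma finite_PF: "finite (PF n k)"
proof (rule finite_subset)
  let ?A = "insert East (North ` {1..n})"
  show "PF n k \<subseteq> {D. set D \<subseteq> ?A \<and> length D = k * n + n}"
  proof
    fix D assume D: "D \<in> PF n k"
    have "length D = easts D + norths D"
    proof (induction D)
      case (Cons s D)
      then show ?case by (cases s) auto
    qed simp
    moreover have "norths D = n"
      using D distinct_card[of "labels D"] by (simp add: PF_def length_labels)
    moreover have "s \<in> ?A" if "s \<in> set D" for s
    proof (cases s)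
      case (North l)
      then have "l \<in> {1..n}" using that D in_labels_iff[of l D] by (simp add: PF_def)
      then show ?thesis using North by simp
    qed simp
    ultimately show "D \<in> {D. set D \<subseteq> ?A \<and> length D = k * n + n}"
      using D by (auto simp: PF_def)
  qed
  show "finite {D. set D \<subseteq> ?A \<and> length D = k * n + n}"
    by (rule finite_lists_length_eq) simp
qed

text \<open>Pmaj contributions give back the heights, the abscissae then give back the numbers of blocked
neighbours, and \<open>parking_determined\<close> applies.\<close>

lemma phi_inj:
  assumes k: "k \<ge> 1"
  shows "inj_on (phi n k) (PF n k)"
proof (rule inj_onI)
  fix D D' assume D: "D \<in> PF n k" and D': "D' \<in> PF n k" and eq: "phi n k D = phi n k D'"
  interpret D: parking_function n k D using k D by unfold_locales
  interpret D': parking_function n k D' using k D' by unfold_locales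
  have ht: "D.ht l = D'.ht l" if "l \<in> {1..n}" for l
    using D.lab_pmaj_phi[OF that] D'.lab_pmaj_phi[OF that] eq by simp
  have "card (D.blocked l) = card (D'.blocked l)" if l: "l \<in> {1..n}" for l
  proof -
    have "(\<Sum>u = 1..n. copies k D.ht (D.ht l) (Suc l) u) = (\<Sum>u = 1..n. copies k D'.ht (D'.ht l) (Suc l) u)"
      using ht l by (intro sum.cong refl) (simp add: copies_def)
    moreover have "D.image_xpos l = D'.image_xpos l"
      using D.phi_props(2)[OF l] D'.phi_props(2)[OF l] eq by simp
    ultimately show ?thesis
      using D.card_blocked_le[of l] D'.card_blocked_le[of l] by (simp add: D.image_xpos_def D'.image_xpos_def)
  qed
  then have "xpos D l = xpos D' l" if "l \<in> {1..n}" for l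
    using parking_determined[OF D.parking_axioms D'.parking_axioms ht _ that]
    by (simp add: D.blocked_def D'.blocked_def)
  then show "D = D'" using PF_eqI[OF k D D'] by blast
qed

theorem theorem3p4:
  fixes n k :: nat
  assumes "n \<ge> 1" and "k \<ge> 1"
  shows "(\<forall>D \<in> PF n k. \<exists>!E. is_phi_image n k D E) \<and>
         bij_betw (phi n k) (PF n k) (PF n k) \<and>
         (\<forall>D \<in> PF n k.
            area n k (phi n k D) = int (dinv n k D) \<and>
            int (pmaj n k (phi n k D)) = area n k D)"
proof (intro conjI ballI)
  have loc: "parking_function n k D" if "D \<in> PF n k" for D
    using that assms by unfold_locales
  have "phi n k ` PF n k \<subseteq> PF n k"
    using parking_function.phi_props(1)[OF loc] by blast
  then show "bij_betw (phi n k) (PF n k) (PF n k)"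
    using endo_inj_surj[OF finite_PF _ phi_inj[OF assms(2)]] phi_inj[OF assms(2)]
    by (simp add: bij_betw_def)
  fix D assume D: "D \<in> PF n k"
  show "\<exists>!E. is_phi_image n k D E" by (rule parking_function.phi_image_unique[OF loc[OF D]])
  show "area n k (phi n k D) = int (dinv n k D)" by (rule parking_function.area_phi[OF loc[OF D]])
  show "int (pmaj n k (phi n k D)) = area n k D" by (rule parking_function.pmaj_phi[OF loc[OF D]])
qed

end
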